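(* Let $n\ge 13$ be an integer, and let $G$ be a connected graph of order $n$ with minimum degree $\delta(G)=2$. If $\rho(G)\ge\rho(\mathcal B_n)$, then $G$ has an even factor unless $G\cong\mathcal B_n$.
   Context: All graphs are finite, simple and undirected. $\rho(G)$ denotes the spectral radius, i.e. the largest eigenvalue of the adjacency matrix of $G$. An even factor of $G$ is a spanning subgraph $F$ of $G$ in which $d_F(v)$ is a positive even integer for every $v\in V(G)$. For $n\ge5$, the graph $\mathcal B_n$ of order $n$ is obtained from a clique $C\cong K_{n-4}$ with a distinguished vertex $a\in V(C)$ by adding four new vertices $b,x_1,x_2,x_3$ and exactly the six edges $ax_i$ and $bx_i$ for $i=1,2,3$. *)

theory Defs
  imports "Jordan_Normal_Form.Spectral_Radius" "Graph_Theory.Graph_Theory"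
begin

text \<open>
  A finite simple undirected graph is a \<^locale>\<open>pair_graph\<close>: a finite symmetric loopfree
  digraph without parallel arcs, each undirected edge being the pair of arcs (u, v), (v, u).
  The degree of a vertex is therefore its out-degree.
\<close>

abbreviation degree_in :: "'a pair_pre_digraph \<Rightarrow> 'a \<Rightarrow> nat" where
  "degree_in G v \<equiv> out_degree (with_proj G) v"

definition min_degree :: "'a pair_pre_digraph \<Rightarrow> nat" where
  "min_degree G = Min (degree_in G ` pverts G)"

definition adjacency_matrix :: "'a pair_pre_digraph \<Rightarrow> 'a list \<Rightarrow> real mat" where
  "adjacency_matrix G vs =
     mat (length vs) (length vs) (\<lambda>(i, j). if (vs ! i, vs ! j) \<in> parcs G then 1 else 0)"

text \<open>
  The spectrum of the adjacency matrix does not depend on the enumeration of the vertices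
  (see \<open>eigenvalue_adjacency_matrix\<close> below), so an arbitrary one is chosen. The
  matrix is real, so \<^const>\<open>spectrum\<close> is its set of real eigenvalues; being symmetric, it has
  no other eigenvalues.
\<close>

definition graph_spectral_radius :: "'a pair_pre_digraph \<Rightarrow> real" (\<open>\<rho>\<close>) where
  "\<rho> G = Max (spectrum (adjacency_matrix G (SOME vs. distinct vs \<and> set vs = pverts G)))"

definition even_factor :: "'a pair_pre_digraph \<Rightarrow> 'a pair_pre_digraph \<Rightarrow> bool" where
  "even_factor F G \<longleftrightarrow> pair_graph F \<and> spanning (with_proj F) (with_proj G) \<and>
     (\<forall>v \<in> pverts F. 0 < degree_in F v \<and> even (degree_in F v))"

text \<open>
  The graph \<open>\<B> n\<close>, meant for n at least 5: the clique is on 0, ..., n - 5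
  with a = 0, and b = n - 4, and the x's are n - 3, n - 2, n - 1.
\<close>

definition B_graph :: "nat \<Rightarrow> nat pair_pre_digraph" (\<open>\<B>\<close>) where
  "\<B> n = (let C = {0..<n - 4}; a = 0; b = n - 4; X = {n - 3, n - 2, n - 1} in
     \<lparr> pverts = C \<union> {b} \<union> X,
       parcs = {(u, v). u \<in> C \<and> v \<in> C \<and> u \<noteq> v} \<union> {a, b} \<times> X \<union> X \<times> {a, b} \<rparr>)"

lemma pair_graph_B: "n \<ge> 5 \<Longrightarrow> pair_graph (\<B> n)"
proof -
  assume n: "n \<ge> 5"
  have fin: "finite (parcs (\<B> n))"
    by (rule finite_subset[of _ "{0..<n} \<times> {0..<n}"]) (use n in \<open>auto simp: B_graph_def Let_def\<close>)
  show ?thesis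
    by unfold_locales (use n fin in \<open>auto simp: B_graph_def Let_def symmetric_def sym_def\<close>)
qed

lemma card_B: "n \<ge> 5 \<Longrightarrow> card (pverts (\<B> n)) = n"
proof -
  assume n: "n \<ge> 5"
  have "pverts (\<B> n) = {0..<n}" using n by (auto simp: B_graph_def Let_def)
  then show ?thesis by simp
qed

lemma eigenvalue_adjacency_matrix:
  assumes vs: "distinct vs" "set vs = pverts G"
  shows "eigenvalue (adjacency_matrix G vs) k \<longleftrightarrow>
    (\<exists>f. (\<exists>v \<in> pverts G. f v \<noteq> 0) \<and>
         (\<forall>v \<in> pverts G. (\<Sum>u | u \<in> pverts G \<and> (v, u) \<in> parcs G. f u) = k * f v))"
    (is "?L \<longleftrightarrow> (\<exists>f. ?nz f \<and> ?ev f)")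
proof -
  let ?n = "length vs" and ?A = "adjacency_matrix G vs"
  have A: "?A \<in> carrier_mat ?n ?n" by (simp add: adjacency_matrix_def)
  have bij: "bij_betw ((!) vs) {0..<?n} (pverts G)"
    using vs by (metis bij_betw_nth atLeast0LessThan)
  have fin: "finite (pverts G)" using vs by (metis List.finite_set)
  have row: "(?A *\<^sub>v vec ?n (\<lambda>i. f (vs ! i))) $ i =
      (\<Sum>u | u \<in> pverts G \<and> (vs ! i, u) \<in> parcs G. f u)" if "i < ?n" for f i
  proof -
    have "(?A *\<^sub>v vec ?n (\<lambda>i. f (vs ! i))) $ i =
        (\<Sum>j = 0..<?n. if (vs ! i, vs ! j) \<in> parcs G then f (vs ! j) else 0)"
      using that by (auto simp: adjacency_matrix_def scalar_prod_def intro!: sum.cong)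
    also have "\<dots> = (\<Sum>u \<in> pverts G. if (vs ! i, u) \<in> parcs G then f u else 0)"
      by (rule sum.reindex_bij_betw[OF bij])
    also have "\<dots> = (\<Sum>u | u \<in> pverts G \<and> (vs ! i, u) \<in> parcs G. f u)"
      using sum.inter_filter[OF fin, of f "\<lambda>u. (vs ! i, u) \<in> parcs G"] by simp
    finally show ?thesis .
  qed
  have all: "(\<forall>v \<in> pverts G. P v) \<longleftrightarrow> (\<forall>i < ?n. P (vs ! i))" for P
    unfolding vs(2)[symmetric] by (rule all_set_conv_all_nth)
  have ev: "eigenvector ?A (vec ?n (\<lambda>i. f (vs ! i))) k \<longleftrightarrow> ?nz f \<and> ?ev f" for f
  proof -
    have "vec ?n (\<lambda>i. f (vs ! i)) \<noteq> 0\<^sub>v ?n \<longleftrightarrow> ?nz f"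
      using all[of "\<lambda>v. f v = 0"] by (auto simp: vec_eq_iff)
    moreover have "?A *\<^sub>v vec ?n (\<lambda>i. f (vs ! i)) = k \<cdot>\<^sub>v vec ?n (\<lambda>i. f (vs ! i)) \<longleftrightarrow> ?ev f"
      unfolding all using A by (auto simp: vec_eq_iff row simp del: index_mult_mat_vec)
    ultimately show ?thesis using A by (auto simp: eigenvector_def)
  qed
  show ?thesis
  proof
    assume ?L
    then obtain v where v: "eigenvector ?A v k" unfolding eigenvalue_def by blast
    define f where "f u = v $ (the_inv_into {0..<?n} ((!) vs) u)" for u
    have "vec ?n (\<lambda>i. f (vs ! i)) = v"
      using v A bij by (auto simp: f_def eigenvector_def bij_betw_def the_inv_into_f_f)
    then show "\<exists>f. ?nz f \<and> ?ev f" using v ev[of f] by auto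
  next
    assume "\<exists>f. ?nz f \<and> ?ev f"
    then show ?L using ev unfolding eigenvalue_def by blast
  qed
qed

end

theory Submission
  imports Defs
begin

text \<open>
  Let \<open>l\<close> be the eigenvalue of \<open>\<B> n\<close> belonging to a positive eigenvector that is constant on the
  symmetry classes of \<open>\<B> n\<close>; it satisfies \<open>n - 5 < l \<le> \<rho> (\<B> n) \<le> \<rho> G\<close>. The absolute value \<open>x\<close> of
  an eigenvector of \<open>G\<close> for \<open>\<rho> G\<close> is then nonnegative, and at every vertex the sum of \<open>x\<close> over the
  neighbours is at least \<open>l\<close> times the value of \<open>x\<close>. Everything is deduced from this subharmonicity,
  connectedness and minimum degree 2. There are three consequences: a vertex where \<open>x\<close> is largest has at most
  three non-neighbours (\<open>ex_large_degree\<close>); the degree sum of \<open>G\<close> is large, by Hong's argument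
  (\<open>degree_sum_lower_bound\<close>); and no positive weighting can be a strict supersolution for \<open>l\<close>
  (\<open>supersolution_tight\<close>).

  The combinatorial idea is to absorb vertices into a set on which every parity problem is solvable.
  Call \<open>Q\<close> flexible if every parity prescription on \<open>Q\<close> with an even number of odd entries is
  realised by the degrees of a subgraph of \<open>G[Q]\<close> without isolated vertices. Once \<open>Q\<close> is flexible,
  edges outside \<open>G[Q]\<close> may be chosen with regard to the degrees outside \<open>Q\<close> alone, since \<open>Q\<close> repairs
  its own degrees (\<open>flexible_absorb\<close>). Hence \<open>Q\<close> can be enlarged by a vertex with two neighbours in
  \<open>Q\<close>, and by two adjacent vertices that both have a neighbour in \<open>Q\<close>. Take \<open>Q\<close> maximal and containing
  a vertex of large degree. The set \<open>X\<close> of outside vertices with a neighbour in \<open>Q\<close> is then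
  independent, each member has exactly one neighbour in \<open>Q\<close>, and the set \<open>M\<close> of remaining vertices has
  at most three elements.

  Counting degrees against Hong's bound leaves very few possibilities for the sizes of \<open>X\<close> and \<open>M\<close>
  (\<open>few_outside\<close>). In most of them some even subgraph visibly covers \<open>X\<close> and \<open>M\<close>, and \<open>Q\<close> completes
  it to an even factor. Two possibilities resist: three outside vertices \<open>M\<close> hanging on a single
  member of \<open>X\<close>, and one vertex \<open>b\<close> joined to exactly three vertices of degree 2. In both, \<open>Q\<close> has
  \<open>n - 4\<close> vertices and the eigenvector of \<open>\<B> n\<close>, transplanted to \<open>G\<close>, is compared with \<open>x\<close>. The first is
  excluded (\<open>no_pendant_attachment\<close>) and the second forces \<open>G\<close> to be \<open>\<B> n\<close> (\<open>B_structure\<close>).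
\<close>

section \<open>Flexible vertex sets\<close>

locale simple_graph =
  fixes V :: "'a set" and E :: "'a rel"
  assumes finite_V: "finite V" and E_subset: "E \<subseteq> V \<times> V"
    and sym_E: "sym E" and irrefl_E: "irrefl E"
begin

lemma E_commute: "(u, v) \<in> E \<longleftrightarrow> (v, u) \<in> E"
  using sym_E by (blast dest: symD)

lemma no_loop [simp]: "(v, v) \<notin> E"
  using irrefl_E by (auto simp: irrefl_def)

lemma finite_Image: "H \<subseteq> E \<Longrightarrow> finite (H `` S)"
  by (rule finite_subset[OF _ finite_V]) (use E_subset in blast)

lemma handshake:
  assumes "H \<subseteq> E" "sym H" "H \<subseteq> S \<times> S" "finite S"
  shows "even (\<Sum>v\<in>S. card (H `` {v}))"
  using assms
proof (induction "card H" arbitrary: H rule: less_induct)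
  case less
  have finH: "finite H" using less.prems(3,4) by (blast intro: finite_subset)
  show ?case
  proof (cases "H = {}")
    case True
    then show ?thesis by simp
  next
    case False
    then obtain u v where uv: "(u, v) \<in> H" by auto
    then have vu: "(v, u) \<in> H" using less.prems by (auto dest: symD)
    have ne: "u \<noteq> v" using uv less.prems by auto
    define K where "K = H - {(u, v), (v, u)}"
    have "card K < card H" using uv finH unfolding K_def by (intro psubset_card_mono) auto
    then have ev: "even (\<Sum>w\<in>S. card (K `` {w}))"
      using less.prems by (intro less.hyps) (auto simp: K_def sym_def)
    have fin: "finite (K `` {w})" for w
      using finH unfolding K_def by (simp add: finite_Image)
    have "card (H `` {w}) = card (K `` {w}) + ((if w = u then 1 else 0) + (if w = v then 1 else 0))" for w
    proof -
      have "w = u \<Longrightarrow> H `` {w} = insert v (K `` {w})" "v \<notin> K `` {u}"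
        and "w = v \<Longrightarrow> H `` {w} = insert u (K `` {w})" "u \<notin> K `` {v}"
        and "w \<noteq> u \<Longrightarrow> w \<noteq> v \<Longrightarrow> H `` {w} = K `` {w}"
        using uv vu ne by (auto simp: K_def)
      then show ?thesis using fin ne by auto
    qed
    then have "(\<Sum>w\<in>S. card (H `` {w})) = (\<Sum>w\<in>S. card (K `` {w})) +
        ((\<Sum>w\<in>S. if w = u then 1 else 0) + (\<Sum>w\<in>S. if w = v then 1 else 0))"
      by (simp add: sum.distrib)
    also have "(\<Sum>w\<in>S. if w = u then 1 else (0::nat)) = 1" 
      using uv less.prems by (auto simp: sum.delta)
    also have "(\<Sum>w\<in>S. if w = v then 1 else (0::nat)) = 1"
      using uv less.prems by (auto simp: sum.delta)
    finally show ?thesis using ev by simp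
  qed
qed

text \<open>
  A parity prescription is a natural-valued \<open>j\<close> of which only the residues modulo 2 matter: in this
  form it can be changed by adding the degrees of further edges.
\<close>

definition parity_factor :: "'a set \<Rightarrow> ('a \<Rightarrow> nat) \<Rightarrow> 'a rel \<Rightarrow> bool" where
  "parity_factor S j H \<longleftrightarrow>
     sym H \<and> H \<subseteq> E \<inter> S \<times> S \<and> (\<forall>v\<in>S. even (card (H `` {v}) + j v))"

text \<open>
  The exception for singletons makes a single vertex flexible, so that a maximal flexible set
  through a given vertex always exists.
\<close>

definition flexible :: "'a set \<Rightarrow> bool" where
  "flexible Q \<longleftrightarrow> Q \<subseteq> V \<and>
     (\<forall>j. even (sum j Q) \<longrightarrow> (\<exists>H. parity_factor Q j H \<and> (\<forall>v\<in>Q. H `` {v} = {} \<longrightarrow> Q = {v})))"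

definition even_cover :: "'a rel \<Rightarrow> bool" where
  "even_cover H \<longleftrightarrow> parity_factor V (\<lambda>_. 0) H \<and> (\<forall>v\<in>V. H `` {v} \<noteq> {})"

text \<open>
  Here \<open>D\<close> collects the chosen edges that are not inside \<open>Q\<close>. They disturb the parities in \<open>Q\<close>, but
  flexibility lets \<open>Q\<close> realise the prescription \<open>j\<close> shifted by the degrees in \<open>D\<close>; the shifted
  prescription has even sum because the degrees in \<open>D\<close> do.
\<close>

lemma flexible_absorb:
  assumes Q: "flexible Q" and P: "P \<subseteq> V" "Q \<inter> P = {}" and j: "even (sum j (Q \<union> P))"
    and D: "sym D" "D \<subseteq> E \<inter> (Q \<union> P) \<times> (Q \<union> P)" "D \<inter> Q \<times> Q = {}"
    and DP: "\<And>p. p \<in> P \<Longrightarrow> even (card (D `` {p}) + j p)" "\<And>p. p \<in> P \<Longrightarrow> D `` {p} \<noteq> {}"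
    and single: "\<And>v. Q = {v} \<Longrightarrow> D `` {v} \<noteq> {}"
  shows "\<exists>H. parity_factor (Q \<union> P) j H \<and> (\<forall>v\<in>Q \<union> P. H `` {v} \<noteq> {})"
proof -
  have QV: "Q \<subseteq> V" using Q by (simp add: flexible_def)
  have finQ: "finite Q" and finP: "finite P" using QV P finite_V by (auto intro: finite_subset)
  define i where "i v = j v + card (D `` {v})" for v
  have "even (\<Sum>v\<in>Q \<union> P. card (D `` {v}))"
    using D finQ finP by (intro handshake) auto
  then have "even (sum i (Q \<union> P))" using j by (simp add: i_def sum.distrib)
  moreover have "even (sum i P)" using DP(1) by (intro dvd_sum) (simp add: i_def add.commute)
  moreover have "sum i (Q \<union> P) = sum i Q + sum i P"
    using finQ finP P(2) by (rule sum.union_disjoint)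
  ultimately have "even (sum i Q)" by simp
  then obtain K where K: "parity_factor Q i K" "\<And>v. v \<in> Q \<Longrightarrow> K `` {v} = {} \<Longrightarrow> Q = {v}"
    using Q unfolding flexible_def by blast
  have Ks: "sym K" "K \<subseteq> E" "K \<subseteq> Q \<times> Q" and Kp: "\<And>v. v \<in> Q \<Longrightarrow> even (card (K `` {v}) + i v)"
    using K(1) by (auto simp: parity_factor_def)
  define H where "H = K \<union> D"
  have HP: "H `` {p} = D `` {p}" if "p \<in> P" for p
    using that Ks P(2) by (auto simp: H_def)
  have HQ: "card (H `` {v}) = card (K `` {v}) + card (D `` {v})" if "v \<in> Q" for v
  proof -
    have "H `` {v} = K `` {v} \<union> D `` {v}" by (auto simp: H_def)
    moreover have "K `` {v} \<inter> D `` {v} = {}" using that Ks D(3) by auto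
    ultimately show ?thesis using Ks D(2) by (simp add: card_Un_disjoint finite_Image)
  qed
  have "parity_factor (Q \<union> P) j H"
    unfolding parity_factor_def
  proof (intro conjI ballI)
    show "sym H" using Ks D(1) by (simp add: H_def sym_Un)
    show "H \<subseteq> E \<inter> (Q \<union> P) \<times> (Q \<union> P)" using Ks D(2) by (auto simp: H_def)
    fix v assume "v \<in> Q \<union> P"
    then show "even (card (H `` {v}) + j v)"
      using HP[of v] HQ[of v] Kp[of v] DP(1)[of v] by (auto simp: i_def)
  qed
  moreover have "H `` {v} \<noteq> {}" if "v \<in> Q \<union> P" for v
    using that K(2)[of v] single[of v] DP(2)[of v] by (auto simp: H_def)
  ultimately show ?thesis by blast
qed

lemma flexible_singleton: "v \<in> V \<Longrightarrow> flexible {v}"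
  unfolding flexible_def parity_factor_def by (auto intro!: exI[of _ "{}"] simp: sym_def)

text \<open>
  The new vertex takes both edges to \<open>a\<close> and \<open>b\<close> if its degree has to be even, and only one of them
  otherwise.
\<close>

lemma flexible_add_vertex:
  assumes Q: "flexible Q" and p: "p \<in> V - Q" and ab: "a \<in> Q" "b \<in> Q" "a \<noteq> b"
    and E: "(p, a) \<in> E" "(p, b) \<in> E"
  shows "flexible (insert p Q)"
proof -
  have "\<exists>H. parity_factor (Q \<union> {p}) j H \<and> (\<forall>v\<in>Q \<union> {p}. H `` {v} \<noteq> {})"
    if j: "even (sum j (Q \<union> {p}))" for j
  proof -
    define S where "S = (if even (j p) then {(p, a), (p, b)} else {(p, a)})"
    have "(S \<union> S\<inverse>) `` {p} = (if even (j p) then {a, b} else {a})"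
      using p ab by (auto simp: S_def)
    moreover have "Q \<noteq> {v}" for v using ab by auto
    ultimately show ?thesis
      using Q j p ab E E_commute by (intro flexible_absorb[where D = "S \<union> S\<inverse>"])
        (auto simp: S_def sym_Un_converse split: if_splits)
  qed
  then have "\<exists>H. parity_factor (insert p Q) j H \<and> (\<forall>v\<in>insert p Q. H `` {v} \<noteq> {})"
    if "even (sum j (insert p Q))" for j
    using that by (simp add: Un_commute)
  with Q p show ?thesis unfolding flexible_def by (metis DiffD1 insert_subset)
qed

text \<open>
  On the path \<open>a, p, p', b\<close> (a cycle if \<open>a = b\<close>) each of the four parity patterns at \<open>p\<close> and \<open>p'\<close> is
  realised by a subset of the three edges that covers both vertices. A path with three inner vertices
  would fail: with parities even, odd, even, covering the first of them leaves the third uncovered.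
\<close>

lemma flexible_add_edge:
  assumes Q: "flexible Q" and p: "p \<in> V - Q" "p' \<in> V - Q" and ab: "a \<in> Q" "b \<in> Q"
    and E: "(p, p') \<in> E" "(p, a) \<in> E" "(p', b) \<in> E"
  shows "flexible (insert p (insert p' Q))"
proof -
  have ne: "p \<noteq> p'" using E by auto
  have "\<exists>H. parity_factor (Q \<union> {p, p'}) j H \<and> (\<forall>v\<in>Q \<union> {p, p'}. H `` {v} \<noteq> {})"
    if j: "even (sum j (Q \<union> {p, p'}))" for j
  proof -
    define S where "S = (if even (j p) then {(p, p'), (p, a)} \<union> (if even (j p') then {(p', b)} else {})
      else if even (j p') then {(p, p'), (p', b)} else {(p, a), (p', b)})"
    have "(S \<union> S\<inverse>) `` {p} = (if even (j p) then {p', a} else if even (j p') then {p'} else {a})"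
      "(S \<union> S\<inverse>) `` {p'} = (if even (j p') then {p, b} else if even (j p) then {p} else {b})"
      using p ab ne by (auto simp: S_def)
    moreover have "(S \<union> S\<inverse>) `` {v} \<noteq> {}" if "Q = {v}" for v using ab that by (auto simp: S_def)
    moreover have "a \<noteq> p'" "b \<noteq> p" using p ab by auto
    ultimately show ?thesis
      using Q j p ab E E_commute ne by (intro flexible_absorb[where D = "S \<union> S\<inverse>"])
        (auto simp: S_def sym_Un_converse split: if_splits)
  qed
  then have "\<exists>H. parity_factor (insert p (insert p' Q)) j H \<and> (\<forall>v\<in>insert p (insert p' Q). H `` {v} \<noteq> {})"
    if "even (sum j (insert p (insert p' Q)))" for j
    using that by (simp add: Un_commute)
  with Q p show ?thesis unfolding flexible_def by (metis DiffD1 insert_subset)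
qed

lemma maximal_flexible:
  assumes v: "v \<in> V"
  obtains Q where "flexible Q" "v \<in> Q"
    "\<forall>p\<in>V - Q. \<forall>a\<in>Q. \<forall>b\<in>Q. (p, a) \<in> E \<longrightarrow> (p, b) \<in> E \<longrightarrow> a = b"
    "\<forall>p\<in>V - Q. \<forall>p'\<in>V - Q. \<forall>a\<in>Q. \<forall>b\<in>Q. (p, a) \<in> E \<longrightarrow> (p', b) \<in> E \<longrightarrow> (p, p') \<notin> E"
proof -
  define \<Q> where "\<Q> = {Q. flexible Q \<and> v \<in> Q}"
  have "finite \<Q>" using finite_V by (auto simp: \<Q>_def flexible_def intro: finite_subset[of _ "Pow V"])
  moreover have "{v} \<in> \<Q>" using flexible_singleton[OF v] by (simp add: \<Q>_def)
  ultimately obtain Q where Q: "Q \<in> \<Q>" "\<And>R. R \<in> \<Q> \<Longrightarrow> Q \<subseteq> R \<Longrightarrow> Q = R"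
    using finite_has_maximal[of \<Q>] by blast
  show ?thesis
  proof (rule that)
    show "flexible Q" "v \<in> Q" using Q(1) by (auto simp: \<Q>_def)
    show "\<forall>p\<in>V - Q. \<forall>a\<in>Q. \<forall>b\<in>Q. (p, a) \<in> E \<longrightarrow> (p, b) \<in> E \<longrightarrow> a = b"
    proof (intro ballI impI, rule ccontr)
      fix p a b
      assume *: "p \<in> V - Q" "a \<in> Q" "b \<in> Q" "(p, a) \<in> E" "(p, b) \<in> E" "a \<noteq> b"
      with Q(1) have "insert p Q \<in> \<Q>" by (auto simp: \<Q>_def intro: flexible_add_vertex)
      with Q(2) *(1) show False by blast
    qed
    show "\<forall>p\<in>V - Q. \<forall>p'\<in>V - Q. \<forall>a\<in>Q. \<forall>b\<in>Q. (p, a) \<in> E \<longrightarrow> (p', b) \<in> E \<longrightarrow> (p, p') \<notin> E"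
    proof (intro ballI impI notI)
      fix p p' a b
      assume *: "p \<in> V - Q" "p' \<in> V - Q" "a \<in> Q" "b \<in> Q" "(p, a) \<in> E" "(p', b) \<in> E" "(p, p') \<in> E"
      with Q(1) have "insert p (insert p' Q) \<in> \<Q>"
        by (auto simp: \<Q>_def intro: flexible_add_edge)
      with Q(2) *(1) show False by blast
    qed
  qed
qed

end

section \<open>Eigenvalues of adjacency matrices\<close>

text \<open>
  A complex eigenvalue exists, and it is real because the Hermitian form of a real symmetric matrix
  takes real values.
\<close>

lemma symmetric_real_mat_has_eigenvalue:
  fixes A :: "real mat"
  assumes A: "A \<in> carrier_mat n n" "n > 0"
    and sym: "\<And>i j. i < n \<Longrightarrow> j < n \<Longrightarrow> A $$ (i, j) = A $$ (j, i)"
  shows "\<exists>k. eigenvalue A k"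
proof -
  let ?C = "map_mat complex_of_real A"
  have C: "?C \<in> carrier_mat n n" using A by simp
  obtain \<mu> where "\<mu> \<in> spectrum ?C" using spectrum_non_empty[OF C A(2)] by blast
  then have \<mu>: "eigenvalue ?C \<mu>" by (simp add: spectrum_def)
  then obtain v where v: "v \<in> carrier_vec n" "v \<noteq> 0\<^sub>v n" "?C *\<^sub>v v = \<mu> \<cdot>\<^sub>v v"
    using A by (auto simp: eigenvalue_def eigenvector_def)
  define S where "S = (\<Sum>i<n. \<Sum>j<n. cnj (v $ i) * A $$ (i, j) * v $ j)"
  define N where "N = (\<Sum>i<n. (cmod (v $ i))\<^sup>2)"
  have row: "(\<Sum>j<n. A $$ (i, j) * v $ j) = \<mu> * v $ i" if "i < n" for i
  proof -
    have "(?C *\<^sub>v v) $ i = (\<Sum>j<n. A $$ (i, j) * v $ j)"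
      using that A v(1) by (auto simp: scalar_prod_def atLeast0LessThan intro!: sum.cong)
    then show ?thesis using v that by simp
  qed
  have "S = (\<Sum>i<n. cnj (v $ i) * (\<mu> * v $ i))"
    by (auto simp: S_def row[symmetric] sum_distrib_left mult.assoc intro!: sum.cong)
  also have "\<dots> = (\<Sum>i<n. \<mu> * of_real ((cmod (v $ i))\<^sup>2))"
    by (simp only: complex_norm_square mult_ac)
  also have "\<dots> = \<mu> * of_real N" by (simp add: N_def sum_distrib_left)
  finally have S: "S = \<mu> * of_real N" .
  have "cnj S = (\<Sum>i<n. \<Sum>j<n. cnj (v $ j) * A $$ (i, j) * v $ i)"
    by (simp add: S_def mult_ac)
  also have "\<dots> = S"
    unfolding S_def by (subst sum.swap) (auto simp: sym intro!: sum.cong)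
  finally have "cnj S = S" .
  obtain i where i: "i < n" "v $ i \<noteq> 0" using v by (auto simp: vec_eq_iff)
  have "N > 0" unfolding N_def by (rule sum_pos2[of _ i]) (use i in auto)
  then have "cnj \<mu> = \<mu>" using \<open>cnj S = S\<close> S by simp
  then obtain k where k: "\<mu> = of_real k" by (metis Reals_cnj_iff Reals_cases)
  have "poly (char_poly ?C) \<mu> = 0" using \<mu> eigenvalue_root_char_poly[OF C] by simp
  then have "poly (char_poly A) k = 0"
    unfolding k of_real_hom.char_poly_hom[OF A(1)] by simp
  then show ?thesis using eigenvalue_root_char_poly[OF A(1)] by blast
qed

lemma spectral_radius_eigenfunction:
  assumes "pair_graph G" "pverts G \<noteq> {}"
  shows "\<exists>f. (\<exists>v\<in>pverts G. f v \<noteq> 0) \<and> (\<forall>v\<in>pverts G. (\<Sum>u\<in>parcs G `` {v}. f u) = \<rho> G * f v)"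
    and "\<lbrakk>v \<in> pverts G; f v \<noteq> 0; \<And>v. v \<in> pverts G \<Longrightarrow> (\<Sum>u\<in>parcs G `` {v}. f u) = k * f v\<rbrakk> \<Longrightarrow> k \<le> \<rho> G"
proof -
  interpret pair_graph G by fact
  define vs where "vs = (SOME vs. distinct vs \<and> set vs = pverts G)"
  have vs: "distinct vs" "set vs = pverts G"
    using someI_ex[of "\<lambda>vs. distinct vs \<and> set vs = pverts G"] finite_distinct_list[OF pair_finite_verts]
    unfolding vs_def by blast+
  let ?A = "adjacency_matrix G vs"
  have A: "?A \<in> carrier_mat (length vs) (length vs)" by (simp add: adjacency_matrix_def)
  have "length vs > 0" using vs assms(2) by auto
  moreover have "(u, v) \<in> parcs G \<longleftrightarrow> (v, u) \<in> parcs G" for u v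
    using pair_sym_arcs by (auto simp: symmetric_def dest: symD)
  ultimately have "\<exists>k. eigenvalue ?A k"
    using A by (intro symmetric_real_mat_has_eigenvalue) (auto simp: adjacency_matrix_def)
  then have ne: "spectrum ?A \<noteq> {}" by (auto simp: spectrum_def)
  have fin: "finite (spectrum ?A)" by (rule card_finite_spectrum[OF A])
  have rho: "\<rho> G = Max (spectrum ?A)" by (simp add: graph_spectral_radius_def vs_def)
  have im: "{u \<in> pverts G. (v, u) \<in> parcs G} = parcs G `` {v}" for v
    by (auto dest: in_arcsD2)
  note ev = eigenvalue_adjacency_matrix[OF vs, unfolded im]
  show "\<exists>f. (\<exists>v\<in>pverts G. f v \<noteq> 0) \<and> (\<forall>v\<in>pverts G. (\<Sum>u\<in>parcs G `` {v}. f u) = \<rho> G * f v)"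
    using Max_in[OF fin ne] unfolding rho[symmetric] ev[symmetric] by (simp add: spectrum_def)
  show "k \<le> \<rho> G" if "v \<in> pverts G" "f v \<noteq> 0"
    "\<And>v. v \<in> pverts G \<Longrightarrow> (\<Sum>u\<in>parcs G `` {v}. f u) = k * f v"
  proof -
    have "eigenvalue ?A k" using that unfolding ev by blast
    then show ?thesis using fin by (simp add: rho spectrum_def)
  qed
qed

text \<open>
  This is the characteristic equation of \<open>\<B> n\<close> on vectors that are constant on symmetry classes.
  Normalise such a vector to 1 on the clique vertices other than \<open>a\<close>. Their rows force the value
  \<open>l - n + 6\<close> at \<open>a\<close>; the rows of \<open>b\<close> and of the three vertices between \<open>a\<close> and \<open>b\<close> then force the
  value \<open>l * (l - n + 6) / (l\<^sup>2 - 3)\<close> on those three, and what remains is the row of \<open>a\<close>. A root above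
  \<open>n - 5\<close> makes the value at \<open>a\<close> exceed 1, and all other values positive.
\<close>

definition B_root :: "nat \<Rightarrow> real \<Rightarrow> bool" where
  "B_root n l \<longleftrightarrow> real n - 5 < l \<and>
     l * (l - n + 6) = real n - 5 + 3 * (l * (l - n + 6) / (l\<^sup>2 - 3))"

text \<open>
  The difference of the two sides of the equation changes sign between \<open>n - 5\<close>, where the value at
  \<open>a\<close> would be 1, and \<open>n - 4\<close>, where it would be 2.
\<close>

lemma ex_B_root:
  assumes n: "n \<ge> 13"
  shows "\<exists>l. B_root n l"
proof -
  define g where "g l = l * (l - n + 6) - (real n - 5) - 3 * (l * (l - n + 6) / (l\<^sup>2 - 3))" for l :: real
  have big: "l\<^sup>2 > 63" if "l \<ge> real n - 5" for l :: real
  proof -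
    have "8 * 8 \<le> l * l" using that n by (intro mult_mono) auto
    then show ?thesis by (simp add: power2_eq_square)
  qed
  have neg: "g (real n - 5) < 0"
    using big[of "real n - 5"] n by (simp add: g_def field_simps)
  have "6 * (real n - 4) / ((real n - 4)\<^sup>2 - 3) < real n - 3"
  proof -
    have "(real n - 3) * ((real n - 4)\<^sup>2 - 3) \<ge> (real n - 4) * 60"
      using big[of "real n - 4"] n by (intro mult_mono) auto
    then show ?thesis using big[of "real n - 4"] n
      by (subst pos_divide_less_eq) auto
  qed
  then have pos: "g (real n - 4) > 0"
    by (simp add: g_def algebra_simps)
  have "\<exists>l\<ge>real n - 5. l \<le> real n - 4 \<and> g l = 0"
  proof (rule IVT')
    show "continuous_on {real n - 5..real n - 4} g"
      unfolding g_def using big by (intro continuous_intros) (force simp: power2_eq_square)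
  qed (use neg pos in auto)
  then obtain l where l: "l \<ge> real n - 5" "g l = 0" by blast
  with neg have "l > real n - 5" by (cases "l = real n - 5") auto
  with l(2) n show ?thesis by (auto simp: B_root_def g_def)
qed

lemma B_root_le_spectral_radius:
  assumes n: "n \<ge> 13" and l: "B_root n l"
  shows "l \<le> \<rho> (\<B> n)"
proof -
  define a where "a = l - n + 6"
  define c where "c = l * a / (l\<^sup>2 - 3)"
  define b where "b = 3 * a / (l\<^sup>2 - 3)"
  have l8: "l > 8" using l n by (simp add: B_root_def)
  then have "8 * 8 \<le> l * l" by (intro mult_mono) auto
  then have l2: "l\<^sup>2 - 3 > 0" by (simp add: power2_eq_square)
  have eq_a: "l * a = real n - 5 + 3 * c" using l n by (simp add: B_root_def a_def c_def)
  have eq_c: "l * c = a + b" using l2 by (simp add: c_def b_def field_simps power2_eq_square)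
  have eq_b: "l * b = 3 * c" by (simp add: c_def b_def)
  define f :: "nat \<Rightarrow> real"
    where "f v = (if v = 0 then a else if v < n - 4 then 1 else if v = n - 4 then b else c)" for v
  let ?X = "{n - 3, n - 2, n - 1}"
  have V: "pverts (\<B> n) = {0..<n}" using n by (auto simp: B_graph_def Let_def)
  have X: "sum f ?X = 3 * c"
  proof -
    have "n - 3 \<notin> {n - 2, n - 1}" "n - 2 \<notin> {n - 1}" using n by auto
    then have "sum f ?X = f (n - 3) + (f (n - 2) + f (n - 1))" by simp
    moreover have "f v = c" if "n - 4 < v" for v using that by (simp add: f_def)
    from this[of "n - 3"] this[of "n - 2"] this[of "n - 1"]
    have "f (n - 3) = c" "f (n - 2) = c" "f (n - 1) = c" using n by auto
    ultimately show ?thesis by simp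
  qed
  have C: "sum f {1..<n - 4} = real n - 5" using n by (simp add: f_def of_nat_diff)
  have nb: "parcs (\<B> n) `` {v} = (if v = 0 then {1..<n - 4} \<union> ?X else if v < n - 4 then {0..<n - 4} - {v}
      else if v = n - 4 then ?X else {0, n - 4})" if "v < n" for v
  proof -
    \<comment> \<open>Naming the three blocks keeps subtraction on the naturals out of the set reasoning.\<close>
    obtain C X b where CXb: "C = {0..<n - 4}" "X = ?X" "b = n - 4" by blast
    have arcs: "parcs (\<B> n) = {(u, v). u \<in> C \<and> v \<in> C \<and> u \<noteq> v} \<union> {0, b} \<times> X \<union> X \<times> {0, b}"
      unfolding CXb by (simp add: B_graph_def Let_def)
    have disj: "0 \<in> C" "b \<notin> C" "0 \<notin> X" "b \<notin> X" "C \<inter> X = {}" "b \<noteq> 0"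
      using n by (auto simp: CXb)
    have "v \<in> C \<longleftrightarrow> v < n - 4" "v \<in> X \<longleftrightarrow> n - 4 < v" "{1..<n - 4} = C - {0}"
      using n that by (auto simp: CXb)
    moreover have "parcs (\<B> n) `` {v} = (if v = 0 then C - {0} \<union> X else if v \<in> C then C - {v}
      else if v = b then X else if v \<in> X then {0, b} else {})"
      unfolding arcs using disj by auto
    ultimately show ?thesis using CXb by simp
  qed
  have eig: "(\<Sum>u\<in>parcs (\<B> n) `` {v}. f u) = l * f v" if "v \<in> pverts (\<B> n)" for v
  proof -
    have vn: "v < n" using that V by simp
    consider "v = 0" | "0 < v" "v < n - 4" | "v = n - 4" | "n - 4 < v" by linarith
    then show ?thesis
    proof cases
      case 1
      have "sum f ({1..<n - 4} \<union> ?X) = sum f {1..<n - 4} + sum f ?X"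
        using n by (intro sum.union_disjoint) auto
      then show ?thesis using 1 nb[OF vn] X C eq_a n by (simp add: f_def of_nat_diff)
    next
      case 2
      have "{0..<n - 4} = insert 0 {1..<n - 4}" using n by auto
      then have "sum f {0..<n - 4} = a + (real n - 5)" using C by (simp add: f_def)
      then have "sum f ({0..<n - 4} - {v}) = a + (real n - 5) - 1"
        using 2 by (simp add: sum_diff1 f_def)
      then show ?thesis using 2 nb[OF vn] n by (simp add: f_def a_def of_nat_diff)
    next
      case 3
      then show ?thesis using nb[OF vn] X eq_b n by (simp add: f_def)
    next
      case 4
      then show ?thesis using nb[OF vn] eq_c n by (simp add: f_def)
    qed
  qed
  have "a > 0" using l n by (simp add: a_def B_root_def)
  then show ?thesis
    using n V eig by (intro spectral_radius_eigenfunction(2)[of _ 0 f] pair_graph_B) (auto simp: f_def)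
qed

section \<open>Subharmonic functions on graphs\<close>

context simple_graph
begin

definition nsum :: "('a \<Rightarrow> real) \<Rightarrow> 'a \<Rightarrow> real" where
  "nsum x v = (\<Sum>u\<in>E `` {v}. x u)"

abbreviation deg :: "'a \<Rightarrow> nat" where
  "deg v \<equiv> card (E `` {v})"

lemma nbr_subset: "E `` {v} \<subseteq> V"
  using E_subset by auto

lemma nsum_adjoint: "(\<Sum>v\<in>V. y v * nsum x v) = (\<Sum>v\<in>V. nsum y v * x v)"
proof -
  have nsum_if: "nsum z v = (\<Sum>u\<in>V. if (v, u) \<in> E then z u else 0)" for z v
  proof -
    have "E `` {v} = {u \<in> V. (v, u) \<in> E}" using E_subset by auto
    then show ?thesis unfolding nsum_def using finite_V by (simp add: sum.inter_filter)
  qed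
  have "(\<Sum>v\<in>V. y v * nsum x v) = (\<Sum>v\<in>V. \<Sum>u\<in>V. if (v, u) \<in> E then y v * x u else 0)"
    by (auto simp: nsum_if sum_distrib_left intro!: sum.cong)
  also have "\<dots> = (\<Sum>u\<in>V. \<Sum>v\<in>V. if (u, v) \<in> E then y v * x u else 0)"
    by (subst sum.swap) (simp add: E_commute)
  also have "\<dots> = (\<Sum>v\<in>V. nsum y v * x v)"
    by (auto simp: nsum_if sum_distrib_right intro!: sum.cong)
  finally show ?thesis .
qed

lemma sum_nsum:
  fixes x :: "'a \<Rightarrow> real"
  shows "(\<Sum>v\<in>V. nsum x v) = (\<Sum>v\<in>V. real (deg v) * x v)"
  using nsum_adjoint[of "\<lambda>_. 1" x] by (simp add: nsum_def)

end

text \<open>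
  The connectedness assumption is phrased as: no proper nonempty set of vertices is closed under
  adjacency. The function \<open>x\<close> will be the absolute value of an eigenvector; that it is a positive
  eigenvector itself comes out of \<open>supersolution_tight\<close>.
\<close>

locale subharmonic_graph = simple_graph +
  fixes l :: real and x :: "'a \<Rightarrow> real"
  assumes x_nonneg: "\<And>v. 0 \<le> x v" and x_nonzero: "\<exists>v\<in>V. x v \<noteq> 0"
    and subharmonic: "\<And>v. v \<in> V \<Longrightarrow> l * x v \<le> nsum x v"
    and l_gt_1: "1 < l"
    and connected: "\<And>S. \<lbrakk>S \<subseteq> V; S \<noteq> {}; E `` S \<subseteq> S\<rbrakk> \<Longrightarrow> S = V"
    and deg_ge_2: "\<And>v. v \<in> V \<Longrightarrow> 2 \<le> deg v"
begin

lemma sum_x_pos: "0 < sum x V"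
  using x_nonzero x_nonneg finite_V by (metis less_le sum_nonneg_eq_0_iff sum_nonneg)

lemma ex_large_degree: "\<exists>v\<in>V. l \<le> deg v"
proof -
  obtain w where w: "w \<in> V" "x w \<noteq> 0" using x_nonzero by blast
  then have "Max (x ` V) \<in> x ` V" using finite_V by (intro Max_in) auto
  then obtain v where v: "v \<in> V" "Max (x ` V) = x v" by blast
  then have max: "x u \<le> x v" if "u \<in> V" for u using finite_V that by (metis Max_ge finite_imageI imageI)
  have "x v > 0" using max[OF w(1)] w(2) x_nonneg[of w] by linarith
  have "l * x v \<le> (\<Sum>u\<in>E `` {v}. x u)" using subharmonic[OF v(1)] by (simp add: nsum_def)
  also have "\<dots> \<le> deg v * x v"
    using max nbr_subset[of v] by (intro sum_bounded_above) auto
  finally show ?thesis using \<open>x v > 0\<close> v(1) by auto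
qed

text \<open>
  Hong's bound for minimum degree 2. Let \<open>A\<close> be the adjacency matrix. Since \<open>A x \<ge> l x\<close>, the entries
  of \<open>(A\<^sup>2 - A) x\<close> sum to at least \<open>l (l - 1)\<close> times the sum of \<open>x\<close>. On the other hand every column sum
  of \<open>A\<^sup>2 - A\<close> is a sum of \<open>deg u - 1\<close> over the neighbours \<open>u\<close> of one vertex \<open>v\<close>. It falls short of
  the same sum over all vertices by \<open>deg v - 1\<close>, and by at least 1 for every non-neighbour of \<open>v\<close>.
\<close>

lemma degree_sum_lower_bound: "l * (l - 1) \<le> (\<Sum>v\<in>V. deg v) - 2 * real (card V) + 2"
proof -
  let ?d = "\<lambda>v. real (deg v) - 1" and ?D = "real (\<Sum>v\<in>V. deg v)" and ?n = "real (card V)"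
  have nb: "nsum ?d v \<le> ?D - 2 * ?n + 2" if v: "v \<in> V" for v
  proof -
    let ?R = "V - insert v (E `` {v})"
    have sub: "insert v (E `` {v}) \<subseteq> V" using nbr_subset v by auto
    have fin: "finite (E `` {v})" by (simp add: finite_Image)
    have cR: "card ?R = card V - (deg v + 1)"
      using sub fin by (simp add: card_Diff_subset)
    have "deg v + 1 \<le> card V" using card_mono[OF finite_V sub] fin by simp
    then have cR': "real (card ?R) = ?n - ?d v - 2" using cR by linarith
    have "?D - ?n = sum ?d V" by (simp add: sum_subtractf)
    also have "\<dots> = sum ?d ?R + sum ?d (insert v (E `` {v}))"
      using sub finite_V by (rule sum.subset_diff)
    also have "sum ?d (insert v (E `` {v})) = ?d v + nsum ?d v"
      using fin by (simp add: nsum_def)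
    finally have "?D - ?n = sum ?d ?R + (?d v + nsum ?d v)" .
    moreover have "real (card ?R) * 1 \<le> sum ?d ?R"
      by (intro sum_bounded_below) (use deg_ge_2 in force)
    ultimately show ?thesis using cR' by linarith
  qed
  have "l * (l * sum x V - sum x V) \<le> l * (sum (nsum x) V - sum x V)"
  proof (intro mult_left_mono)
    have "l * sum x V \<le> sum (nsum x) V"
      unfolding sum_distrib_left by (intro sum_mono subharmonic)
    then show "l * sum x V - sum x V \<le> sum (nsum x) V - sum x V" by simp
  qed (use l_gt_1 in simp)
  also have "\<dots> = (\<Sum>v\<in>V. ?d v * (l * x v))"
  proof -
    have "(\<Sum>v\<in>V. ?d v * (l * x v)) = l * ((\<Sum>v\<in>V. deg v * x v) - sum x V)"
    proof -
      have "?d v * (l * x v) = l * (deg v * x v) - l * x v" for v by (simp add: algebra_simps)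
      then have "(\<Sum>v\<in>V. ?d v * (l * x v)) = (\<Sum>v\<in>V. l * (deg v * x v)) - (\<Sum>v\<in>V. l * x v)"
        by (simp only: sum_subtractf)
      then show ?thesis by (simp only: sum_distrib_left right_diff_distrib)
    qed
    also have "(\<Sum>v\<in>V. deg v * x v) = sum (nsum x) V" by (rule sum_nsum[symmetric])
    finally show ?thesis by simp
  qed
  also have "\<dots> \<le> (\<Sum>v\<in>V. ?d v * nsum x v)"
  proof (intro sum_mono mult_left_mono subharmonic)
    show "0 \<le> ?d v" if "v \<in> V" for v using deg_ge_2[OF that] by simp
  qed auto
  also have "\<dots> = (\<Sum>v\<in>V. nsum ?d v * x v)" by (rule nsum_adjoint)
  also have "\<dots> \<le> (\<Sum>v\<in>V. (?D - 2 * ?n + 2) * x v)"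
    by (intro sum_mono mult_right_mono nb x_nonneg)
  also have "\<dots> = (?D - 2 * ?n + 2) * sum x V" by (simp add: sum_distrib_left)
  finally have "(l * (l - 1)) * sum x V \<le> (?D - 2 * ?n + 2) * sum x V" by (simp add: algebra_simps)
  then show ?thesis using sum_x_pos by simp
qed

text \<open>
  Write \<open>A x\<close> for \<open>nsum x\<close>. Testing \<open>A x - l x \<ge> 0\<close> against a positive \<open>y\<close> gives the same number as
  testing \<open>A y - l y\<close> against \<open>x\<close>. If the latter is nonpositive, then \<open>A x = l x\<close> everywhere, and connectedness spreads positivity
  of \<open>x\<close> from one vertex to all.
\<close>

lemma supersolution_tight:
  assumes y: "\<And>v. v \<in> V \<Longrightarrow> 0 < y v"
    and le: "(\<Sum>v\<in>V. (nsum y v - l * y v) * x v) \<le> 0"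
  shows "v \<in> V \<Longrightarrow> 0 < x v" and "(\<Sum>v\<in>V. (nsum y v - l * y v) * x v) = 0"
proof -
  have nonneg: "0 \<le> y v * (nsum x v - l * x v)" if "v \<in> V" for v
    using y[OF that] subharmonic[OF that] by simp
  have eq: "(\<Sum>v\<in>V. y v * (nsum x v - l * x v)) = (\<Sum>v\<in>V. (nsum y v - l * y v) * x v)"
    using nsum_adjoint[of y x] by (simp add: algebra_simps sum_subtractf)
  have ge: "(\<Sum>v\<in>V. y v * (nsum x v - l * x v)) \<ge> 0" by (intro sum_nonneg nonneg)
  show zero: "(\<Sum>v\<in>V. (nsum y v - l * y v) * x v) = 0" using eq ge le by linarith
  then have "\<forall>v\<in>V. y v * (nsum x v - l * x v) = 0"
    using sum_nonneg_eq_0_iff[OF finite_V nonneg] eq by simp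
  then have harm: "nsum x v = l * x v" if "v \<in> V" for v
    using y[OF that] that by fastforce
  have "{v \<in> V. 0 < x v} = V"
  proof (rule connected)
    show "{v \<in> V. 0 < x v} \<noteq> {}" using x_nonzero x_nonneg less_le by force
    have "0 < x u" if "(v, u) \<in> E" "v \<in> V" "0 < x v" for u v
    proof -
      have u: "u \<in> V" "v \<in> E `` {u}" using that E_subset E_commute by auto
      have "x v \<le> nsum x u" unfolding nsum_def
        using u x_nonneg by (intro member_le_sum finite_Image) auto
      then have "0 < l * x u" using that harm[OF u(1)] by simp
      then show ?thesis using l_gt_1 by (simp add: zero_less_mult_iff)
    qed
    then show "E `` {v \<in> V. 0 < x v} \<subseteq> {v \<in> V. 0 < x v}" using E_subset by auto
  qed auto
  then show "v \<in> V \<Longrightarrow> 0 < x v" by blast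
qed

end

section \<open>A maximal flexible set and the vertices outside it\<close>

text \<open>
  The situation around a maximal flexible set \<open>Q\<close>: the vertices of \<open>X\<close> have exactly one neighbour in
  \<open>Q\<close>, called their foot, and those of \<open>M\<close> have none.
\<close>

locale flexible_core = subharmonic_graph +
  fixes n :: nat and Q X M :: "'a set" and foot :: "'a \<Rightarrow> 'a"
  assumes n_ge: "n \<ge> 13" and card_V: "card V = n" and B_root: "B_root n l"
    and flexible_Q: "flexible Q"
    and V_eq: "V = Q \<union> X \<union> M" and disj: "Q \<inter> X = {}" "Q \<inter> M = {}" "X \<inter> M = {}"
    and Q_ne: "Q \<noteq> {}"
    and foot: "\<And>p. p \<in> X \<Longrightarrow> E `` {p} \<inter> Q = {foot p}"
    and X_indep: "\<And>p p'. p \<in> X \<Longrightarrow> p' \<in> X \<Longrightarrow> (p, p') \<notin> E"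
    and M_Q: "\<And>m. m \<in> M \<Longrightarrow> E `` {m} \<inter> Q = {}"
    and card_M: "card M \<le> 3"
begin

lemma finite_parts [simp]: "finite Q" "finite X" "finite M"
  using finite_V V_eq by auto

lemma n_split: "card Q + card X + card M = n"
  using card_V V_eq disj by (subst (asm) V_eq) (simp add: card_Un_disjoint Int_Un_distrib2)

lemma foot_in: "p \<in> X \<Longrightarrow> foot p \<in> Q" "p \<in> X \<Longrightarrow> (p, foot p) \<in> E"
  using foot by blast+

lemma nbrs_eq_pair:
  assumes "v \<in> V" "E `` {v} \<subseteq> {p, q}"
  shows "E `` {v} = {p, q}"
proof (rule card_seteq)
  show "card {p, q} \<le> deg v" using deg_ge_2[OF assms(1)] by (simp add: card_insert_if)
qed (use assms in auto)

lemma nbr_X: "p \<in> X \<Longrightarrow> E `` {p} \<subseteq> insert (foot p) M"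
  using foot X_indep nbr_subset[of p] V_eq by blast

lemma nbr_M: "m \<in> M \<Longrightarrow> E `` {m} \<subseteq> X \<union> (M - {m})"
  using M_Q nbr_subset[of m] V_eq by auto

lemma nbr_Q: 
  assumes "v \<in> Q" shows "E `` {v} = (E `` {v} \<inter> Q) \<union> {p \<in> X. foot p = v}"
proof -
  have "(v, p) \<in> E \<longleftrightarrow> foot p = v" if "p \<in> X" for p
  proof -
    have "(v, p) \<in> E \<longleftrightarrow> v \<in> E `` {p} \<inter> Q" using assms E_commute[of v p] by simp
    then show ?thesis using foot[OF that] by auto
  qed
  moreover have "(v, m) \<notin> E" if "m \<in> M" for m
    using M_Q[OF that] assms E_commute by blast
  ultimately show ?thesis using nbr_subset[of v] V_eq by blast
qed

lemma nsum_core: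
  assumes "v \<in> Q"
  shows "nsum y v = sum y (E `` {v} \<inter> Q) + sum y {p \<in> X. foot p = v}"
proof -
  have "sum y (E `` {v} \<inter> Q \<union> {p \<in> X. foot p = v}) = sum y (E `` {v} \<inter> Q) + sum y {p \<in> X. foot p = v}"
    using disj(1) by (intro sum.union_disjoint) auto
  then show ?thesis unfolding nsum_def nbr_Q[OF assms, symmetric] .
qed

lemma sum_foot_fibres:
  fixes g :: "'a \<Rightarrow> real"
  shows "(\<Sum>v\<in>Q. real (card {p \<in> X. foot p = v}) * g v) = (\<Sum>p\<in>X. g (foot p))"
proof -
  have "(\<Sum>p\<in>X. g (foot p)) = (\<Sum>v\<in>Q. \<Sum>p | p \<in> X \<and> foot p = v. g (foot p))"
    using foot_in(1) by (intro sum.group[symmetric]) auto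
  then show ?thesis by simp
qed

lemma degree_sum_upper_bound:
  "(\<Sum>v\<in>V. deg v) \<le> real (card Q) * (real (card Q) - 1) + 2 * real (card X) + 2 * real (card M) * real (card X)
    + real (card M) * (real (card M) - 1)"
proof -
  let ?s = "real (card Q)" and ?x = "real (card X)" and ?k = "real (card M)"
  have dQ: "real (deg v) \<le> (?s - 1) + real (card {p \<in> X. foot p = v}) * 1" if "v \<in> Q" for v
  proof -
    have "E `` {v} \<subseteq> (Q - {v}) \<union> {p \<in> X. foot p = v}" using nbr_Q[OF that] by auto
    then have "deg v \<le> card ((Q - {v}) \<union> {p \<in> X. foot p = v})" by (intro card_mono) auto
    also have "\<dots> \<le> card (Q - {v}) + card {p \<in> X. foot p = v}" by (rule card_Un_le)
    also have "card (Q - {v}) = card Q - 1" using that by simp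
    finally have "deg v \<le> card Q - 1 + card {p \<in> X. foot p = v}" .
    moreover have "card Q \<ge> 1" using Q_ne by (simp add: Suc_le_eq card_gt_0_iff)
    ultimately show ?thesis by linarith
  qed
  have dX: "real (deg p) \<le> 1 + ?k" if "p \<in> X" for p
  proof -
    have "deg p \<le> card (insert (foot p) M)" using nbr_X[OF that] by (intro card_mono) auto
    also have "\<dots> \<le> 1 + card M" by (simp add: card_insert_if)
    finally show ?thesis by simp
  qed
  have dM: "real (deg m) \<le> ?x + (?k - 1)" if "m \<in> M" for m
  proof -
    have "deg m \<le> card (X \<union> (M - {m}))" using nbr_M[OF that] by (intro card_mono) auto
    also have "\<dots> \<le> card X + card (M - {m})" by (rule card_Un_le)
    moreover have "card M \<ge> 1" using that by (auto simp: Suc_le_eq card_gt_0_iff)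
    ultimately show ?thesis using that by (simp add: of_nat_diff)
  qed
  have "(\<Sum>v\<in>V. real (deg v)) = (\<Sum>v\<in>Q. real (deg v)) + (\<Sum>v\<in>X. real (deg v)) + (\<Sum>v\<in>M. real (deg v))"
    unfolding V_eq using disj by (simp add: sum.union_disjoint Int_Un_distrib2)
  also have "\<dots> \<le> (\<Sum>v\<in>Q. (?s - 1) + real (card {p \<in> X. foot p = v}) * 1) + (\<Sum>v\<in>X. 1 + ?k) + (\<Sum>v\<in>M. ?x + (?k - 1))"
    by (intro add_mono sum_mono dQ dX dM)
  also have "(\<Sum>v\<in>Q. (?s - 1) + real (card {p \<in> X. foot p = v}) * 1) = ?s * (?s - 1) + ?x"
    unfolding sum.distrib sum_foot_fibres[of "\<lambda>_. 1"] by simp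
  finally show ?thesis by (simp add: algebra_simps)
qed

text \<open>
  The upper and lower bounds on the degree sum contradict each other for larger \<open>X\<close>. The
  upper bound is a convex function of \<open>card X\<close>, so only the two ends of the excluded range matter; the
  products in the proof express this.
\<close>

lemma few_outside:
  shows "card M = 1 \<Longrightarrow> card X \<le> 4"
    and "card M = 2 \<Longrightarrow> card X \<le> 2"
    and "card M = 3 \<Longrightarrow> card X \<le> 1"
proof -
  define s where "s = real (card Q)"
  define x where "x = real (card X)"
  define k where "k = real (card M)"
  define m where "m = real n"
  note s_x_k_m_def = s_def x_def k_def m_def
  have l: "m - 5 < l" using B_root by (simp add: B_root_def m_def)
  have m: "m \<ge> 13" using n_ge by (simp add: m_def)
  have "(m - 5) * (m - 6) \<le> l * (l - 1)" using l m by (intro mult_mono) auto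
  moreover have "(m - 5) * (m - 6) \<noteq> l * (l - 1)"
    using mult_strict_mono[of "m - 5" l "m - 6" "l - 1"] l m by auto
  moreover have "l * (l - 1) \<le> s * (s - 1) + 2 * x + 2 * k * x + k * (k - 1) - 2 * m + 2"
    using degree_sum_lower_bound degree_sum_upper_bound by (simp add: s_x_k_m_def card_V)
  ultimately have *: "(m - 5) * (m - 6) < s * (s - 1) + 2 * x + 2 * k * x + k * (k - 1) - 2 * m + 2"
    by linarith
  have s: "s = m - x - k" using n_split by (simp add: s_x_k_m_def flip: of_nat_add)
  have "1 \<le> card Q" using Q_ne by (simp add: Suc_le_eq card_gt_0_iff)
  then have s1: "x + k + 1 \<le> m" using s by (simp add: s_def)
  show "card X \<le> 4" if "card M = 1"
  proof (rule ccontr)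
    assume "\<not> ?thesis"
    then have x: "x \<ge> 5" by (simp add: s_x_k_m_def)
    have k: "k = 1" using that by (simp add: s_x_k_m_def)
    have "(x - 5) * (m - 2 - x) \<ge> 0" "(m - 10) * (x - 5) \<ge> 0" using x s1 k m by auto
    then show False using * m unfolding s k by (simp add: algebra_simps)
  qed
  show "card X \<le> 2" if "card M = 2"
  proof (rule ccontr)
    assume "\<not> ?thesis"
    then have x: "x \<ge> 3" by (simp add: s_x_k_m_def)
    have k: "k = 2" using that by (simp add: s_x_k_m_def)
    have "(x - 3) * (m - 3 - x) \<ge> 0" "(m - 11) * (x - 3) \<ge> 0" using x s1 k m by auto
    then show False using * m unfolding s k by (simp add: algebra_simps)
  qed
  show "card X \<le> 1" if "card M = 3"
  proof (rule ccontr)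
    assume "\<not> ?thesis"
    then have x: "x \<ge> 2" by (simp add: s_x_k_m_def)
    have k: "k = 3" using that by (simp add: s_x_k_m_def)
    have "(x - 2) * (m - 4 - x) \<ge> 0" "(m - 13) * (x - 2) \<ge> 0" using x s1 k m by auto
    then show False using * m unfolding s k by (simp add: algebra_simps)
  qed
qed

lemma X_nonempty: "M \<noteq> {} \<Longrightarrow> X \<noteq> {}"
proof
  assume M: "M \<noteq> {}" and "X = {}"
  then have "E `` Q \<subseteq> Q" using nbr_Q by blast
  then have "Q = V" using Q_ne V_eq by (intro connected) auto
  then show False using M disj V_eq by blast
qed

text \<open>
  The form in which \<open>flexible_absorb\<close> finishes a construction: outside \<open>Q\<close> all degrees have to be even
  and positive, at \<open>Q\<close> nothing has to be checked.
\<close>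

lemma even_cover_absorb:
  assumes Q: "card Q \<noteq> 1" and D: "sym D" "D \<subseteq> E" "D \<inter> Q \<times> Q = {}"
    and even: "\<And>p. p \<in> X \<union> M \<Longrightarrow> even (card (D `` {p}))" "\<And>p. p \<in> X \<union> M \<Longrightarrow> D `` {p} \<noteq> {}"
  shows "\<exists>H. even_cover H"
proof -
  have "\<exists>H. parity_factor (Q \<union> (X \<union> M)) (\<lambda>_. 0) H \<and> (\<forall>v\<in>Q \<union> (X \<union> M). H `` {v} \<noteq> {})"
    using flexible_Q D disj even Q V_eq E_subset
    by (intro flexible_absorb[where D = D]) auto
  then show ?thesis unfolding even_cover_def using V_eq by (simp add: Un_assoc)
qed

lemma large_core: "M \<noteq> {} \<Longrightarrow> card Q \<noteq> 1"
proof -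
  assume "M \<noteq> {}"
  then have "card M = 1 \<or> card M = 2 \<or> card M = 3"
    using card_M card_0_eq[OF finite_parts(3)] by linarith
  then show ?thesis using few_outside n_split n_ge by linarith
qed

lemma even_cover_if_no_M:
  assumes "M = {}"
  shows "\<exists>H. even_cover H"
proof -
  have "X = {}"
  proof (rule ccontr)
    assume "X \<noteq> {}"
    then obtain p where p: "p \<in> X" by blast
    then have "deg p \<le> card {foot p}" using nbr_X[OF p] assms by (intro card_mono) auto
    then show False using deg_ge_2[of p] p V_eq by auto
  qed
  then have "card Q \<noteq> 1" using n_split n_ge assms by simp
  then show ?thesis using \<open>X = {}\<close> assms by (intro even_cover_absorb[of "{}"]) (auto simp: sym_def)
qed

text \<open>
  Both edges at every vertex of \<open>X\<close> are forced, and they give the single vertex of \<open>M\<close> the degree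
  \<open>card X\<close>.
\<close>

lemma even_cover_if_card_M_1:
  assumes M: "card M = 1" and even: "even (card X)"
  shows "\<exists>H. even_cover H"
proof -
  obtain b where b: "M = {b}" using M by (auto simp: card_1_singleton_iff)
  have nbr_X: "E `` {p} = {foot p, b}" if p: "p \<in> X" for p
    using nbr_X[OF p] b p V_eq by (intro nbrs_eq_pair) auto
  have nbr_b: "E `` {b} = X"
  proof
    show "E `` {b} \<subseteq> X" using nbr_M[of b] b by auto
    show "X \<subseteq> E `` {b}" using nbr_X E_commute by blast
  qed
  have ne: "foot p \<noteq> b" if "p \<in> X" for p using foot_in[OF that] b disj by auto
  define D where "D = E - Q \<times> Q"
  have DE: "D `` {p} = E `` {p}" if "p \<in> X \<union> M" for p using that disj by (auto simp: D_def)
  show ?thesis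
  proof (rule even_cover_absorb[of D])
    show "card Q \<noteq> 1" using large_core b by simp
    show "sym D" using sym_E by (auto simp: D_def sym_def)
    show "Restr D Q = {}" by (auto simp: D_def)
    show "even (card (D `` {p}))" if "p \<in> X \<union> M" for p
      using that DE[OF that] nbr_X[of p] nbr_b ne[of p] even b by auto
    show "D `` {p} \<noteq> {}" if "p \<in> X \<union> M" for p
      using that DE[OF that] nbr_X[of p] nbr_b X_nonempty b by auto
  qed (auto simp: D_def)
qed

text \<open>
  If \<open>X\<close> has one element, it forms a triangle with \<open>M\<close>. If it has two, either \<open>X\<close> and \<open>M\<close> form a
  4-cycle, or the edge inside \<open>M\<close> lies on a path from \<open>Q\<close> back to \<open>Q\<close> through all four vertices.
\<close>

lemma even_cover_if_card_M_2:
  assumes M: "card M = 2"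
  shows "\<exists>H. even_cover H"
proof -
  obtain b c where bc: "M = {b, c}" "b \<noteq> c" using M by (auto simp: card_2_iff)
  have core: "card Q \<noteq> 1" using large_core bc by simp
  have bc_nX: "b \<notin> X" "c \<notin> X" "b \<notin> Q" "c \<notin> Q" using bc disj by auto
  have nb: "E `` {b} \<subseteq> insert c X" "E `` {c} \<subseteq> insert b X" using nbr_M[of b] nbr_M[of c] bc by auto
  have bVc: "b \<in> V" "c \<in> V" using bc V_eq by auto
  have X: "X \<noteq> {}" "card X \<le> 2" using X_nonempty bc few_outside(2) M by auto
  then have "0 < card X" by (simp add: card_gt_0_iff)
  then consider (one) u where "X = {u}" | (two) u w where "X = {u, w}" "u \<noteq> w"
    using X(2) by (metis One_nat_def Suc_leI card_1_singletonE card_2_iff le_SucE le_antisym numeral_2_eq_2)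
  then show ?thesis
  proof cases
    case one
    have "E `` {b} = {c, u}" "E `` {c} = {b, u}"
      using nb one bVc by (blast intro!: nbrs_eq_pair)+
    then have E: "(b, u) \<in> E" "(c, u) \<in> E" "(b, c) \<in> E" by auto
    define S where "S = {(u, b), (u, c), (b, c)}"
    show ?thesis
    proof (rule even_cover_absorb[OF core, of "S \<union> S\<inverse>"])
      show "S \<union> S\<inverse> \<subseteq> E" using E E_commute by (auto simp: S_def)
      show "Restr (S \<union> S\<inverse>) Q = {}" using bc_nX by (auto simp: S_def)
      have "(S \<union> S\<inverse>) `` {u} = {b, c}" "(S \<union> S\<inverse>) `` {b} = {u, c}" "(S \<union> S\<inverse>) `` {c} = {u, b}"
        using one bc_nX bc by (auto simp: S_def)
      then show "even (card ((S \<union> S\<inverse>) `` {p}))" "(S \<union> S\<inverse>) `` {p} \<noteq> {}" if "p \<in> X \<union> M" for p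
        using that one bc bc_nX by auto
    qed (simp add: sym_Un_converse)
  next
    case two
    have uw: "u \<notin> Q" "w \<notin> Q" using two disj by auto
    show ?thesis
    proof (cases "(b, c) \<in> E")
      case False
      have "E `` {b} = {u, w}" "E `` {c} = {u, w}"
        using nb two False E_commute[of b c] bVc by (blast intro!: nbrs_eq_pair)+
      then have E: "(b, u) \<in> E" "(c, u) \<in> E" "(b, w) \<in> E" "(c, w) \<in> E" by auto
      define S where "S = {(u, b), (u, c), (w, b), (w, c)}"
      show ?thesis
      proof (rule even_cover_absorb[OF core, of "S \<union> S\<inverse>"])
        show "S \<union> S\<inverse> \<subseteq> E" using E E_commute by (auto simp: S_def)
        show "Restr (S \<union> S\<inverse>) Q = {}" using bc_nX by (auto simp: S_def)
        have "(S \<union> S\<inverse>) `` {u} = {b, c}" "(S \<union> S\<inverse>) `` {w} = {b, c}"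
          "(S \<union> S\<inverse>) `` {b} = {u, w}" "(S \<union> S\<inverse>) `` {c} = {u, w}"
          using two bc_nX bc by (auto simp: S_def)
        then show "even (card ((S \<union> S\<inverse>) `` {p}))" "(S \<union> S\<inverse>) `` {p} \<noteq> {}" if "p \<in> X \<union> M" for p
          using that two bc bc_nX by auto
      qed (simp add: sym_Un_converse)
    next
      case True
      have ex: "\<exists>p\<in>X. (m, p) \<in> E" if m: "m \<in> M" for m
      proof (rule ccontr)
        assume "\<not> ?thesis"
        then have "E `` {m} \<subseteq> M - {m}" using nbr_M[OF m] by blast
        then have "deg m \<le> card (M - {m})" by (intro card_mono) auto
        then show False using deg_ge_2[of m] m V_eq M by simp
      qed
      have ex': "\<exists>m\<in>M. (m, p) \<in> E" if p: "p \<in> X" for p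
      proof (rule ccontr)
        assume "\<not> ?thesis"
        then have "E `` {p} \<subseteq> {foot p}" using nbr_X[OF p] E_commute by blast
        then have "deg p \<le> card {foot p}" by (intro card_mono) auto
        then show False using deg_ge_2[of p] p V_eq by simp
      qed
      obtain p q where pq: "X = {p, q}" "p \<noteq> q" "(b, p) \<in> E" "(c, q) \<in> E"
        using ex[of b] ex[of c] ex'[of u] ex'[of w] two bc(1) by auto
      define S where "S = {(p, foot p), (p, b), (b, c), (c, q), (q, foot q)}"
      have f: "foot p \<in> Q" "foot q \<in> Q" "(p, foot p) \<in> E" "(q, foot q) \<in> E" "p \<notin> Q" "q \<notin> Q"
        using foot_in pq(1) disj by auto
      show ?thesis
      proof (rule even_cover_absorb[OF core, of "S \<union> S\<inverse>"])
        show "S \<union> S\<inverse> \<subseteq> E" using f pq True E_commute by (auto simp: S_def)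
        show "Restr (S \<union> S\<inverse>) Q = {}" using bc_nX f by (auto simp: S_def)
        have "(S \<union> S\<inverse>) `` {p} = {foot p, b}" "(S \<union> S\<inverse>) `` {q} = {foot q, c}"
          "(S \<union> S\<inverse>) `` {b} = {p, c}" "(S \<union> S\<inverse>) `` {c} = {b, q}"
          using f pq bc_nX bc(2) by (auto simp: S_def)
        moreover have "foot p \<noteq> b" "foot q \<noteq> c" "p \<noteq> c" "b \<noteq> q" using f bc_nX pq(1) by auto
        ultimately show "even (card ((S \<union> S\<inverse>) `` {v}))" "(S \<union> S\<inverse>) `` {v} \<noteq> {}" if "v \<in> X \<union> M" for v
          using that pq(1) bc by auto
      qed (simp add: sym_Un_converse)
    qed
  qed
qed

section \<open>Spectral comparison with the extremal graph\<close>

text \<open>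
  The entry at \<open>a\<close> of the positive eigenvector of \<open>\<B> n\<close> that is 1 on the rest of the clique.
\<close>

definition alpha :: real where "alpha = l - n + 6"

lemma spectral_bounds: "8 < l" "1 < alpha"
  using B_root n_ge by (auto simp: B_root_def alpha_def)

lemma l_alpha: "l * alpha = real n - 5 + 3 * (l * alpha / (l\<^sup>2 - 3))"
  using B_root by (simp add: B_root_def alpha_def)

lemma l_squared: "0 < l\<^sup>2 - 3"
proof -
  have "8 * 8 \<le> l * l" using spectral_bounds by (intro mult_mono) auto
  then show ?thesis by (simp add: power2_eq_square)
qed

lemma sum_clique_weights:
  assumes "a \<in> Q" "y a = alpha" "\<And>v. v \<in> Q - {a} \<Longrightarrow> y v = (1::real)" "v \<in> Q"
  shows "sum y (Q - {v}) = alpha + real (card Q) - 1 - y v"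
proof -
  have "sum y (Q - {a}) = real (card Q) - 1"
    using assms(1,3) Q_ne by (simp add: of_nat_diff Suc_le_eq card_gt_0_iff)
  moreover have "sum y Q = y a + sum y (Q - {a})" by (rule sum.remove) (use assms in auto)
  moreover have "sum y Q = y v + sum y (Q - {v})" by (rule sum.remove) (use assms in auto)
  ultimately show ?thesis using assms(2) by simp
qed

text \<open>
  A single edge joins \<open>Q\<close> to the four outside vertices, whereas in \<open>\<B> n\<close> three edges leave the clique
  at \<open>a\<close>. Give \<open>Q\<close> the clique entries of the eigenvector of \<open>\<B> n\<close>, with \<open>alpha\<close> at the foot. The slack at
  the foot pays for generous weights outside: twice \<open>alpha / l\<close> on \<open>X\<close> and \<open>alpha / l\<close> on \<open>M\<close>. The
  result is a supersolution that is strict at the vertex of \<open>X\<close>.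
\<close>

lemma no_pendant_attachment: "\<not> (card M = 3 \<and> card X = 1)"
proof
  assume MX: "card M = 3 \<and> card X = 1"
  then obtain u where u: "X = {u}" by (auto simp: card_1_singleton_iff)
  define a where "a = foot u"
  have a: "a \<in> Q" using foot_in u by (simp add: a_def)
  have uQ: "u \<notin> Q" "u \<notin> M" using u disj by auto
  have s: "real (card Q) = real n - 4" using n_split MX by linarith
  define w where "w = alpha / l"
  define y where "y v = (if v \<in> Q then if v = a then alpha else 1 else if v \<in> M then w else 2 * w)" for v
  have l8: "8 < l" and al: "1 < alpha" by (fact spectral_bounds)+
  have w: "0 < w" "l * w = alpha" using l8 al by (auto simp: w_def)
  have y_pos: "0 < y v" for v using w al by (simp add: y_def)
  have nsum_Q: "nsum y v \<le> l * y v" if v: "v \<in> Q" for v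
  proof -
    have "nsum y v = sum y (E `` {v} \<inter> Q) + sum y {p \<in> X. foot p = v}"
      by (rule nsum_core[OF v])
    also have "sum y (E `` {v} \<inter> Q) \<le> sum y (Q - {v})"
      using y_pos by (intro sum_mono2) (auto intro: less_imp_le)
    also have "sum y (Q - {v}) = alpha + real (card Q) - 1 - y v"
      using a v by (intro sum_clique_weights) (auto simp: y_def)
    finally have le: "nsum y v \<le> alpha + real (card Q) - 1 - y v + sum y {p \<in> X. foot p = v}" by simp
    show ?thesis
    proof (cases "v = a")
      case True
      have "{p \<in> X. foot p = v} = {u}" using u True by (auto simp: a_def)
      then have "nsum y v \<le> real n - 5 + 2 * w" using le s True a uQ by (simp add: y_def)
      moreover have "w \<le> l * alpha / (l\<^sup>2 - 3)"
        using l_squared al l8 by (simp add: w_def field_simps power2_eq_square)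
      ultimately have "nsum y v \<le> l * alpha" using l_alpha w(1) by linarith
      then show ?thesis using True a by (simp add: y_def)
    next
      case False
      have "{p \<in> X. foot p = v} = {}" using u False by (auto simp: a_def)
      then have "nsum y v \<le> alpha + real (card Q) - 1 - y v" using le by (simp only: sum.empty)
      then show ?thesis using s False v by (simp add: y_def alpha_def)
    qed
  qed
  have nsum_u: "nsum y u < l * y u"
  proof -
    have "nsum y u \<le> sum y (insert a M)"
      unfolding nsum_def using nbr_X[of u] u y_pos by (intro sum_mono2) (auto simp: a_def intro: less_imp_le)
    also have "\<dots> = alpha + sum y M" using a disj by (subst sum.insert) (auto simp: y_def)
    also have "sum y M = (\<Sum>v\<in>M. w)" using disj by (intro sum.cong) (auto simp: y_def)
    also have "alpha + \<dots> = alpha + 3 * w" using MX by simp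
    also have "\<dots> < l * (2 * w)" using w mult_strict_right_mono[OF l8 w(1)] by linarith
    also have "2 * w = y u" using uQ by (simp add: y_def)
    finally show ?thesis .
  qed
  have nsum_M: "nsum y v \<le> l * y v" if v: "v \<in> M" for v
  proof -
    have "nsum y v \<le> sum y (insert u (M - {v}))"
      unfolding nsum_def using nbr_M[OF v] u y_pos by (intro sum_mono2) (auto intro: less_imp_le)
    also have "\<dots> = 2 * w + sum y (M - {v})" using uQ by (subst sum.insert) (auto simp: y_def)
    also have "sum y (M - {v}) = (\<Sum>v\<in>M - {v}. w)" using disj by (intro sum.cong) (auto simp: y_def)
    also have "2 * w + \<dots> = 4 * w" using MX v by simp
    also have "\<dots> \<le> l * w" using w l8 by (intro mult_right_mono) auto
    also have "\<dots> = l * y v" using v disj by (auto simp: y_def)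
    finally show ?thesis .
  qed
  have le: "nsum y v \<le> l * y v" if "v \<in> V" for v
    using that nsum_Q nsum_M nsum_u u V_eq by (auto intro: less_imp_le)
  have nonpos: "(nsum y v - l * y v) * x v \<le> 0" if "v \<in> V" for v
    using le[OF that] x_nonneg[of v] by (simp add: mult_nonpos_nonneg)
  have uV: "u \<in> V" using u V_eq by auto
  have "(\<Sum>v\<in>V. (nsum y v - l * y v) * x v) \<le> 0" by (intro sum_nonpos nonpos)
  from supersolution_tight[OF y_pos this]
  have "0 < x u" and zero: "(\<Sum>v\<in>V. (nsum y v - l * y v) * x v) = 0" using uV by auto
  have "(\<Sum>v\<in>V. - ((nsum y v - l * y v) * x v)) = 0" unfolding sum_negf zero by simp
  moreover have "0 \<le> - ((nsum y v - l * y v) * x v)" if "v \<in> V" for v using nonpos[OF that] by simp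
  ultimately have "(nsum y u - l * y u) * x u = 0"
    using sum_nonneg_eq_0_iff[OF finite_V, of "\<lambda>v. - ((nsum y v - l * y v) * x v)"] uV by simp
  then show False using \<open>0 < x u\<close> nsum_u by simp
qed

text \<open>
  Give \<open>Q\<close>, \<open>X\<close> and \<open>b\<close> the entries of the eigenvector of \<open>\<B> n\<close>, where \<open>alpha\<close> goes to the vertex \<open>a\<close> of
  \<open>Q\<close> at which \<open>x\<close> is largest. Compared with \<open>\<B> n\<close>, the graph may have lost edges inside \<open>Q\<close> and may
  have feet other than \<open>a\<close>. Moving a foot away from \<open>a\<close> replaces \<open>x a\<close> by a value that is not larger and
  \<open>alpha\<close> by 1, so all differences have the same sign; tightness then says that no edge is lost and that every foot
  is \<open>a\<close>.
\<close>

lemma B_structure: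
  assumes M: "card M = 1" and X: "card X = 3"
  obtains a b where "a \<in> Q" "M = {b}"
    "E = {(u, v). u \<in> Q \<and> v \<in> Q \<and> u \<noteq> v} \<union> {a, b} \<times> X \<union> X \<times> {a, b}"
proof -
  obtain b where b: "M = {b}" using M by (auto simp: card_1_singleton_iff)
  have "Max (x ` Q) \<in> x ` Q" using Q_ne by (intro Max_in) auto
  then obtain a where a: "a \<in> Q" "Max (x ` Q) = x a" by blast
  have max: "x v \<le> x a" if "v \<in> Q" for v using that a(2) by (metis Max_ge finite_imageI finite_parts(1) imageI)
  have nbr_X': "E `` {p} = {foot p, b}" if p: "p \<in> X" for p
    using nbr_X[OF p] b p V_eq by (intro nbrs_eq_pair) auto
  have nbr_b: "E `` {b} = X"
  proof
    show "E `` {b} \<subseteq> X" using nbr_M[of b] b by auto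
    show "X \<subseteq> E `` {b}" using nbr_X' E_commute by blast
  qed
  have bn: "b \<notin> Q" "b \<notin> X" using b disj by auto
  have s: "real (card Q) = real n - 4" using n_split M X by linarith
  define c where "c = l * alpha / (l\<^sup>2 - 3)"
  define \<beta> where "\<beta> = 3 * alpha / (l\<^sup>2 - 3)"
  have l8: "8 < l" and al: "1 < alpha" by (fact spectral_bounds)+
  have pos: "0 < c" "0 < \<beta>" using l8 al l_squared by (auto simp: c_def \<beta>_def)
  have l_c: "l * c = alpha + \<beta>" using l_squared by (simp add: c_def \<beta>_def field_simps power2_eq_square)
  have l_b: "l * \<beta> = 3 * c" by (simp add: c_def \<beta>_def)
  have l_a: "l * alpha = real n - 5 + 3 * c" unfolding c_def by (rule l_alpha)
  define z where "z v = (if v \<in> Q then if v = a then alpha else 1 else if v = b then \<beta> else c)" for v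
  have z_pos: "0 < z v" for v using pos al by (simp add: z_def)
  \<comment> \<open>The weight that \<open>v\<close> misses because \<open>Q\<close> need not be a clique.\<close>
  define e where "e v = sum z (Q - {v} - E `` {v})" for v
  have e_nonneg: "0 \<le> e v" for v unfolding e_def using z_pos by (intro sum_nonneg) (auto intro: less_imp_le)
  have nsum_Q: "nsum z v - l * z v = c * card {p \<in> X. foot p = v} - (if v = a then 3 * c else 0) - e v"
    if v: "v \<in> Q" for v
  proof -
    have "nsum z v = sum z (E `` {v} \<inter> Q) + sum z {p \<in> X. foot p = v}"
      by (rule nsum_core[OF v])
    also have "sum z {p \<in> X. foot p = v} = (\<Sum>p | p \<in> X \<and> foot p = v. c)"
      using disj bn by (intro sum.cong) (auto simp: z_def)
    also have "\<dots> = c * card {p \<in> X. foot p = v}" by simp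
    also have "sum z (E `` {v} \<inter> Q) = sum z (Q - {v}) - e v"
    proof -
      have "E `` {v} \<inter> Q \<subseteq> Q - {v}" by auto
      moreover have "Q - {v} - (E `` {v} \<inter> Q) = Q - {v} - E `` {v}" by auto
      ultimately show ?thesis unfolding e_def using sum.subset_diff[of "E `` {v} \<inter> Q" "Q - {v}" z] by simp
    qed
    also have "sum z (Q - {v}) = alpha + real (card Q) - 1 - z v"
      using a(1) v by (intro sum_clique_weights) (auto simp: z_def)
    finally have eq: "nsum z v = alpha + real (card Q) - 1 - z v - e v + c * card {p \<in> X. foot p = v}" .
    show ?thesis
    proof (cases "v = a")
      case True
      then have "z v = alpha" using v by (simp add: z_def)
      then show ?thesis using eq True s l_a by simp
    next
      case False
      then have "z v = 1" using v by (simp add: z_def)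
      then show ?thesis using eq False s by (simp add: alpha_def)
    qed
  qed
  have nsum_X: "nsum z p - l * z p = z (foot p) - alpha" if p: "p \<in> X" for p
  proof -
    have "foot p \<noteq> b" using foot_in[OF p] bn by auto
    then have "nsum z p = z (foot p) + z b" by (simp add: nsum_def nbr_X'[OF p])
    moreover have "z p = c" "z b = \<beta>" using p disj bn by (auto simp: z_def)
    ultimately show ?thesis using l_c by simp
  qed
  have nsum_b: "nsum z b - l * z b = 0"
  proof -
    have "nsum z b = (\<Sum>p\<in>X. c)" unfolding nsum_def nbr_b using disj bn by (intro sum.cong) (auto simp: z_def)
    then show ?thesis using X bn l_b by (simp add: z_def)
  qed
  have z_foot: "z (foot p) \<le> alpha" if "p \<in> X" for p using foot_in[OF that] al by (auto simp: z_def)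
  let ?T1 = "c * ((\<Sum>p\<in>X. x (foot p)) - 3 * x a)" and ?T2 = "\<Sum>v\<in>Q. e v * x v"
    and ?T3 = "\<Sum>p\<in>X. (alpha - z (foot p)) * x p"
  have "(\<Sum>v\<in>Q. (nsum z v - l * z v) * x v) =
      (\<Sum>v\<in>Q. c * (card {p \<in> X. foot p = v} * x v) - (if v = a then 3 * c * x v else 0) - e v * x v)"
    by (intro sum.cong) (auto simp: nsum_Q algebra_simps)
  also have "\<dots> = c * (\<Sum>v\<in>Q. card {p \<in> X. foot p = v} * x v) - 3 * c * x a - ?T2"
    using a(1) by (simp add: sum_subtractf sum_distrib_left)
  also have "\<dots> = ?T1 - ?T2" unfolding sum_foot_fibres by (simp add: algebra_simps)
  finally have sumQ: "(\<Sum>v\<in>Q. (nsum z v - l * z v) * x v) = ?T1 - ?T2" .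
  have sumX: "(\<Sum>v\<in>X. (nsum z v - l * z v) * x v) = - ?T3"
    unfolding sum_negf[symmetric] by (intro sum.cong) (auto simp: nsum_X algebra_simps)
  \<comment> \<open>The contributions of feet where \<open>x\<close> is below \<open>x a\<close>, of missing edges in \<open>Q\<close>, and of feet other than \<open>a\<close>.\<close>
  have total: "(\<Sum>v\<in>V. (nsum z v - l * z v) * x v) = ?T1 - ?T2 - ?T3"
    using sumQ sumX nsum_b disj unfolding V_eq b by (simp add: sum.union_disjoint Int_Un_distrib2)
  have "(\<Sum>p\<in>X. x (foot p)) \<le> (\<Sum>p\<in>X. x a)" by (intro sum_mono max foot_in)
  then have T1: "?T1 \<le> 0" using X pos by (simp add: mult_nonneg_nonpos)
  have T2: "0 \<le> ?T2" by (intro sum_nonneg mult_nonneg_nonneg e_nonneg x_nonneg)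
  have T3: "0 \<le> ?T3" using z_foot x_nonneg by (intro sum_nonneg mult_nonneg_nonneg) auto
  have "(\<Sum>v\<in>V. (nsum z v - l * z v) * x v) \<le> 0" using total T1 T2 T3 by linarith
  from supersolution_tight[OF z_pos this]
  have x_pos: "\<And>v. v \<in> V \<Longrightarrow> 0 < x v" and "(\<Sum>v\<in>V. (nsum z v - l * z v) * x v) = 0" by auto
  then have T0: "?T2 = 0" "?T3 = 0" using total T1 T2 T3 by linarith+
  have clique: "Q - {v} \<subseteq> E `` {v}" if v: "v \<in> Q" for v
  proof -
    have "e v * x v = 0"
      using T0(1) v e_nonneg x_nonneg by (simp add: sum_nonneg_eq_0_iff)
    then have "sum z (Q - {v} - E `` {v}) = 0" using x_pos[of v] v V_eq by (auto simp: e_def)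
    moreover have "0 \<le> z w" for w using z_pos[of w] by linarith
    ultimately have "\<forall>w\<in>Q - {v} - E `` {v}. z w = 0" by (simp add: sum_nonneg_eq_0_iff)
    then show ?thesis using z_pos by (auto simp: less_le)
  qed
  have foot_a: "foot p = a" if p: "p \<in> X" for p
  proof -
    have "(alpha - z (foot p)) * x p = 0"
      using T0(2) p z_foot x_nonneg by (simp add: sum_nonneg_eq_0_iff)
    then have "z (foot p) = alpha" using x_pos[of p] p V_eq by auto
    then show ?thesis using foot_in[OF p] al by (auto simp: z_def split: if_splits)
  qed
  have "E = {(u, v). u \<in> Q \<and> v \<in> Q \<and> u \<noteq> v} \<union> {a, b} \<times> X \<union> X \<times> {a, b}" (is "_ = ?E")
  proof -
    have "(u, v) \<in> E \<longleftrightarrow> (u, v) \<in> ?E" for u v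
    proof -
      have nQ: "E `` {u} = Q - {u} \<union> (if u = a then X else {})" if "u \<in> Q"
      proof -
        have "E `` {u} \<inter> Q = Q - {u}" using clique[OF that] by auto
        moreover have "{p \<in> X. foot p = u} = (if u = a then X else {})" using foot_a by auto
        ultimately show ?thesis using nbr_Q[OF that] by simp
      qed
      have nX: "E `` {u} = {a, b}" if "u \<in> X" using nbr_X'[OF that] foot_a[OF that] by simp
      have "v \<in> E `` {u} \<longleftrightarrow> (u, v) \<in> ?E"
      proof (cases "u \<in> V")
        case True
        then show ?thesis using nQ nX nbr_b V_eq b disj a(1) bn by (auto split: if_splits)
      next
        case False
        then show ?thesis using E_subset V_eq a(1) b by auto
      qed
      then show ?thesis by simp
    qed
    then show ?thesis by (intro subset_antisym subrelI) blast+
  qed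
  then show ?thesis using that a(1) b by blast
qed

lemma even_cover_or_B_structure:
  "(\<exists>H. even_cover H) \<or> (\<exists>a b. a \<in> Q \<and> M = {b} \<and> card X = 3 \<and>
    E = {(u, v). u \<in> Q \<and> v \<in> Q \<and> u \<noteq> v} \<union> {a, b} \<times> X \<union> X \<times> {a, b})"
proof -
  have M: "M = {} \<or> card M = 1 \<or> card M = 2 \<or> card M = 3"
    using card_M card_0_eq[OF finite_parts(3)] by linarith
  have X: "M = {} \<or> 0 < card X" using X_nonempty by (auto simp: card_gt_0_iff)
  consider "M = {}" | "card M = 1" "even (card X)" | "card M = 1" "card X = 3" | "card M = 1" "card X = 1"
    | "card M = 2" | "card M = 3" "card X = 1"
  proof (cases "card M = 1")
    case True
    then have "M \<noteq> {}" by auto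
    then have "card X \<noteq> 0" "card X \<le> 4" using X few_outside(1) True by auto
    then have "even (card X) \<or> card X = 1 \<or> card X = 3" by presburger
    with True that(2,3,4) show ?thesis by blast
  next
    case False
    have "card M = 3 \<Longrightarrow> M \<noteq> {}" by auto
    then have "card M = 3 \<Longrightarrow> card X = 1" using X few_outside(3) by fastforce
    with False M that(1,5,6) show ?thesis by blast
  qed
  then show ?thesis
  proof cases
    case 4
    then obtain b where b: "M = {b}" by (auto simp: card_1_singleton_iff)
    then have "E `` {b} \<subseteq> X" using nbr_M[of b] by auto
    then have "deg b \<le> card X" by (intro card_mono) auto
    then show ?thesis using deg_ge_2[of b] b V_eq 4 by simp
  qed (use even_cover_if_no_M even_cover_if_card_M_1 even_cover_if_card_M_2 no_pendant_attachment B_structure in blast)+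
qed

end

text \<open>
  The vertex of large degree is put into the maximal flexible set because then all its neighbours lie in
  \<open>Q\<close> or in \<open>X\<close>, which leaves at most three vertices for \<open>M\<close>.
\<close>

lemma (in subharmonic_graph) even_cover_or_B_graph:
  assumes n: "n \<ge> 13" "card V = n" and root: "B_root n l"
  shows "(\<exists>H. even_cover H) \<or> (\<exists>Q X a b. V = Q \<union> X \<union> {b} \<and> Q \<inter> X = {} \<and> b \<notin> Q \<and> b \<notin> X \<and> a \<in> Q \<and> card X = 3 \<and>
    E = {(u, v). u \<in> Q \<and> v \<in> Q \<and> u \<noteq> v} \<union> {a, b} \<times> X \<union> X \<times> {a, b})"
proof -
  obtain v where v: "v \<in> V" "l \<le> deg v" using ex_large_degree by blast
  have deg_v: "n \<le> deg v + 4" using v(2) root by (simp add: B_root_def)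
  obtain Q where Q: "flexible Q" "v \<in> Q"
    and Q1: "\<forall>p\<in>V - Q. \<forall>a\<in>Q. \<forall>b\<in>Q. (p, a) \<in> E \<longrightarrow> (p, b) \<in> E \<longrightarrow> a = b"
    and Q2: "\<forall>p\<in>V - Q. \<forall>p'\<in>V - Q. \<forall>a\<in>Q. \<forall>b\<in>Q. (p, a) \<in> E \<longrightarrow> (p', b) \<in> E \<longrightarrow> (p, p') \<notin> E"
    by (rule maximal_flexible[OF v(1)])
  have QV: "Q \<subseteq> V" using Q(1) by (simp add: flexible_def)
  define X where "X = {p \<in> V - Q. \<exists>a\<in>Q. (p, a) \<in> E}"
  define M where "M = V - Q - X"
  define foot where "foot p = (SOME a. a \<in> Q \<and> (p, a) \<in> E)" for p
  have foot: "foot p \<in> Q" "(p, foot p) \<in> E" if "p \<in> X" for p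
    using that someI_ex[of "\<lambda>a. a \<in> Q \<and> (p, a) \<in> E"] by (auto simp: X_def foot_def)
  have "insert v (E `` {v}) \<subseteq> Q \<union> X"
    using Q(2) nbr_subset[of v] E_commute by (auto simp: X_def)
  moreover have "finite (Q \<union> X)" using QV finite_V by (auto simp: X_def intro: finite_subset)
  ultimately have "card (insert v (E `` {v})) \<le> card (Q \<union> X)" by (intro card_mono)
  then have "n \<le> card (Q \<union> X) + 3" using deg_v by (simp add: finite_Image)
  moreover have "card M = card V - card (Q \<union> X)"
  proof -
    have "M = V - (Q \<union> X)" by (auto simp: M_def)
    then show ?thesis using QV finite_V by (auto simp: X_def intro!: card_Diff_subset intro: finite_subset)
  qed
  ultimately have card_M: "card M \<le> 3" using n by simp
  interpret flexible_core V E l x n Q X M foot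
  proof unfold_locales
    show "V = Q \<union> X \<union> M" using QV by (auto simp: M_def X_def)
    show "E `` {p} \<inter> Q = {foot p}" if "p \<in> X" for p
    proof -
      have "a = foot p" if "a \<in> E `` {p} \<inter> Q" for a
        using that Q1 foot[OF \<open>p \<in> X\<close>] \<open>p \<in> X\<close> by (auto simp: X_def)
      then show ?thesis using foot[OF that] by blast
    qed
    show "(p, p') \<notin> E" if "p \<in> X" "p' \<in> X" for p p'
      using that foot[OF that(1)] foot[OF that(2)] Q2 by (auto simp: X_def)
    show "Q \<inter> X = {}" "Q \<inter> M = {}" "X \<inter> M = {}" "Q \<noteq> {}" using Q(2) by (auto simp: M_def X_def)
    show "E `` {m} \<inter> Q = {}" if "m \<in> M" for m using that by (auto simp: M_def X_def)
    show "13 \<le> n" "card V = n" "B_root n l" "flexible Q" "card M \<le> 3" by fact+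
  qed
  from even_cover_or_B_structure show ?thesis
  proof (elim disjE exE conjE)
    fix a b
    assume "a \<in> Q" "M = {b}" "card X = 3"
      "E = {(u, v). u \<in> Q \<and> v \<in> Q \<and> u \<noteq> v} \<union> {a, b} \<times> X \<union> X \<times> {a, b}"
    moreover have "V = Q \<union> X \<union> {b}" "b \<notin> Q" "b \<notin> X" using V_eq disj \<open>M = {b}\<close> by auto
    ultimately show ?thesis using disj(1)
      by (intro disjI2 exI[of _ Q] exI[of _ X] exI[of _ a] exI[of _ b] conjI)
  next
    fix H assume "even_cover H"
    then show ?thesis by (intro disjI1 exI[of _ H])
  qed
qed

section \<open>Transfer to digraphs and the theorem\<close>

lemma pair_graph_simple_graph:
  assumes "pair_graph G" shows "simple_graph (pverts G) (parcs G)"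
proof -
  interpret pair_graph G by fact
  have "(a, a) \<notin> parcs G" for a using pair_no_loops by force
  then show ?thesis
    using pair_finite_verts in_arcsD1 in_arcsD2 pair_sym_arcs
    by unfold_locales (auto simp: symmetric_def irrefl_def)
qed

lemma degree_in_eq_card_Image: "degree_in G v = card (parcs G `` {v})"
proof -
  have "out_arcs (with_proj G) v = Pair v ` (parcs G `` {v})"
    by (auto simp: out_arcs_def)
  then show ?thesis by (simp add: out_degree_def card_image inj_on_def)
qed

lemma connected_closed_set:
  assumes "Digraph_Component.connected (with_proj G)"
    and S: "S \<subseteq> pverts G" "S \<noteq> {}" "parcs G `` S \<subseteq> S" and sym: "sym (parcs G)"
  shows "S = pverts G"
proof -
  obtain u where u: "u \<in> S" using S by blast
  have arcs: "parcs (mk_symmetric (with_proj G)) = parcs G"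
    using sym by (auto simp: parcs_mk_symmetric dest: symD)
  have "v \<in> S" if "v \<in> pverts G" for v
  proof -
    have "u \<rightarrow>\<^sup>*\<^bsub>mk_symmetric (with_proj G)\<^esub> v"
      using assms(1) u S(1) that by (auto simp: Digraph_Component.connected_def strongly_connected_def)
    then have "(u, v) \<in> (parcs G)\<^sup>*" using reachable_rtranclI by (fastforce simp: arcs)
    then show ?thesis by (induction) (use u S(3) in auto)
  qed
  then show ?thesis using S(1) by blast
qed

text \<open>
  The components \<open>iso_tail\<close> and \<open>iso_head\<close> of the isomorphism must be the projections, since they
  become the tail and head functions of the image digraph.
\<close>

lemma digraph_iso_B_graph:
  assumes G: "pair_graph G" "card (pverts G) = n" "n \<ge> 13"
    and V: "pverts G = Q \<union> X \<union> {b}" "Q \<inter> X = {}" "b \<notin> Q" "b \<notin> X" and a: "a \<in> Q" and X: "card X = 3"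
    and E: "parcs G = {(u, v). u \<in> Q \<and> v \<in> Q \<and> u \<noteq> v} \<union> {a, b} \<times> X \<union> X \<times> {a, b}"
  shows "digraph_iso (with_proj G) (with_proj (\<B> n))"
proof -
  interpret pair_graph G by fact
  have fin: "finite Q" "finite X" using pair_finite_verts V by auto
  have "card (pverts G) = card Q + card X + 1" using V fin by (simp add: card_Un_disjoint)
  then have cQ: "card Q = n - 4" using G X by simp
  let ?X = "{n - 3, n - 2, n - 1}"
  have "card (Q - {a}) = card {1..<n - 4}" using cQ a by simp
  then obtain g where g: "bij_betw g (Q - {a}) {1..<n - 4}"
    using fin finite_same_card_bij[of "Q - {a}" "{1..<n - 4}"] by blast
  have "n - 3 \<notin> {n - 2, n - 1}" "n - 2 \<notin> {n - 1}" using G(3) by auto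
  then have "card X = card ?X" using X by simp
  then obtain h where h: "bij_betw h X ?X"
    using fin finite_same_card_bij[of X ?X] by blast
  define f where "f u = (if u = a then 0 else if u = b then n - 4 else if u \<in> Q then g u else h u)" for u
  obtain C Y c where CYc: "C = {0..<n - 4}" "Y = ?X" "c = n - 4" by blast
  have C0: "{1..<n - 4} = C - {0}" "0 \<in> C" "c \<notin> C" "c \<notin> Y" "C \<inter> Y = {}" using G(3) by (auto simp: CYc)
  have fa: "f a = 0" and fb: "f b = c" using a V by (auto simp: f_def CYc)
  have f_g: "f u = g u" if "u \<in> Q - {a}" for u using that V by (auto simp: f_def)
  have f_h: "f u = h u" if "u \<in> X" for u using that V a by (auto simp: f_def)
  have bij_Q: "bij_betw f (Q - {a}) (C - {0})" 
    using g unfolding C0(1) by (subst bij_betw_cong[OF f_g])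
  have bij_X: "bij_betw f X Y" 
    using h unfolding CYc(2) by (subst bij_betw_cong[OF f_h])
  have "f ` Q = insert (f a) (f ` (Q - {a}))" using a by (metis image_insert insert_Diff)
  then have fQ: "f ` Q = C" using bij_Q C0(2) by (simp add: fa bij_betw_def insert_absorb)
  have fX: "f ` X = Y" using bij_X by (simp add: bij_betw_def)
  have inj: "inj_on f (pverts G)"
  proof -
    have "inj_on f (insert a (Q - {a}))"
      unfolding inj_on_insert using bij_Q fa by (simp add: bij_betw_def)
    then have "inj_on f Q" using a by (simp only: insert_Diff)
    moreover have "inj_on f X" using bij_X by (simp add: bij_betw_def)
    moreover have "f ` (Q - X) \<inter> f ` (X - Q) = {}" using fQ fX C0(5) by fast
    ultimately have "inj_on f (Q \<union> X)" by (simp only: inj_on_Un simp_thms)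
    moreover have "f b \<notin> f ` (Q \<union> X)" unfolding fb image_Un fQ fX using C0(3,4) by simp
    ultimately have "inj_on f (insert b (Q \<union> X))" unfolding inj_on_insert by blast
    then show ?thesis by (simp add: V(1))
  qed
  have B: "pverts (\<B> n) = C \<union> {c} \<union> Y"
    "parcs (\<B> n) = {(u, v). u \<in> C \<and> v \<in> C \<and> u \<noteq> v} \<union> {0, c} \<times> Y \<union> Y \<times> {0, c}"
    unfolding CYc by (simp_all add: B_graph_def Let_def insert_commute)
  have "map_prod f f ` {(u, v). u \<in> Q \<and> v \<in> Q \<and> u \<noteq> v} = {(u, v). u \<in> C \<and> v \<in> C \<and> u \<noteq> v}"
  proof -
    have "f u = f v \<longleftrightarrow> u = v" if "u \<in> Q" "v \<in> Q" for u v
      using that inj V(1) by (intro inj_on_eq_iff[OF inj]) auto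
    then have "(f u, f v) \<in> {(u, v). u \<in> C \<and> v \<in> C \<and> u \<noteq> v} \<longleftrightarrow> u \<noteq> v" if "u \<in> Q" "v \<in> Q" for u v
      using that fQ by auto
    then show ?thesis
    proof (intro subset_antisym subrelI)
      fix u v assume "(u, v) \<in> {(u, v). u \<in> C \<and> v \<in> C \<and> u \<noteq> v}"
      then obtain p q where "p \<in> Q" "q \<in> Q" "u = f p" "v = f q" "p \<noteq> q" using fQ by blast
      then show "(u, v) \<in> map_prod f f ` {(u, v). u \<in> Q \<and> v \<in> Q \<and> u \<noteq> v}"
        by (intro image_eqI[of _ _ "(p, q)"]) auto
    qed auto
  qed
  moreover have "map_prod f f ` ({a, b} \<times> X) = {0, c} \<times> Y" "map_prod f f ` (X \<times> {a, b}) = Y \<times> {0, c}"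
    using fa fb fX by (simp_all add: map_prod_surj_on)
  ultimately have arcs: "map_prod f f ` parcs G = parcs (\<B> n)"
    unfolding E B by (simp only: image_Un)
  have verts: "f ` pverts G = pverts (\<B> n)"
    unfolding V B using fQ fX fb by auto
  let ?i = "\<lparr>iso_verts = f, iso_arcs = map_prod f f, iso_head = snd, iso_tail = fst\<rparr>"
  have "inj_on (map_prod f f) (parcs G)"
    using map_prod_inj_on[OF inj inj] by (rule inj_on_subset) (auto dest: in_arcsD1 in_arcsD2)
  then have "digraph_isomorphism ?i"
    using inj wf_digraph_axioms by (auto simp: digraph_isomorphism_def)
  moreover have "with_proj (\<B> n) = app_iso ?i (with_proj G)"
    using arcs verts by (simp add: with_proj_def app_iso_def)
  ultimately show ?thesis unfolding digraph_iso_def by blast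
qed

theorem theorem1p2:
  fixes n :: nat and G :: "'a pair_pre_digraph"
  assumes "n \<ge> 13"
    and "pair_graph G"
    and "card (pverts G) = n"
    and "Digraph_Component.connected (with_proj G)"
    and "min_degree G = 2"
    and "\<rho> G \<ge> \<rho> (\<B> n)"
    and "\<not> digraph_iso (with_proj G) (with_proj (\<B> n))"
  shows "\<exists>F. even_factor F G"
proof -
  interpret pair_graph G by fact
  interpret simple_graph "pverts G" "parcs G" using assms(2) by (rule pair_graph_simple_graph)
  obtain l where l: "B_root n l" using ex_B_root assms(1) by blast
  have l_le: "l \<le> \<rho> G" using B_root_le_spectral_radius[OF assms(1) l] assms(6) by simp
  have ne: "pverts G \<noteq> {}" using assms(1,3) by auto
  obtain f where f: "\<exists>v\<in>pverts G. f v \<noteq> 0"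
    "\<And>v. v \<in> pverts G \<Longrightarrow> (\<Sum>u\<in>parcs G `` {v}. f u) = \<rho> G * f v"
    using spectral_radius_eigenfunction(1)[OF assms(2) ne] by blast
  have sub: "subharmonic_graph (pverts G) (parcs G) l (\<lambda>v. \<bar>f v\<bar>)"
  proof unfold_locales
    show "\<exists>v\<in>pverts G. \<bar>f v\<bar> \<noteq> 0" using f(1) by simp
    show "l * \<bar>f v\<bar> \<le> nsum (\<lambda>v. \<bar>f v\<bar>) v" if "v \<in> pverts G" for v
    proof -
      have "l * \<bar>f v\<bar> \<le> \<bar>\<rho> G\<bar> * \<bar>f v\<bar>" using l_le by (intro mult_right_mono) auto
      also have "\<dots> = \<bar>\<Sum>u\<in>parcs G `` {v}. f u\<bar>" using f(2)[OF that] by (simp add: abs_mult)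
      also have "\<dots> \<le> nsum (\<lambda>v. \<bar>f v\<bar>) v" unfolding nsum_def by (rule sum_abs)
      finally show ?thesis .
    qed
    show "1 < l" using l assms(1) by (simp add: B_root_def)
    show "S = pverts G" if "S \<subseteq> pverts G" "S \<noteq> {}" "parcs G `` S \<subseteq> S" for S
      using assms(4) that sym_E by (rule connected_closed_set)
    show "2 \<le> deg v" if "v \<in> pverts G" for v
    proof -
      have "min_degree G \<le> degree_in G v"
        unfolding min_degree_def using that pair_finite_verts by (intro Min_le) auto
      then show ?thesis using assms(5) by (simp add: degree_in_eq_card_Image)
    qed
  qed auto
  have "\<exists>H. even_cover H"
    using subharmonic_graph.even_cover_or_B_graph[OF sub assms(1,3) l]
  proof (elim disjE exE conjE)
    fix Q X a b
    assume "pverts G = Q \<union> X \<union> {b}" "Q \<inter> X = {}" "b \<notin> Q" "b \<notin> X" "a \<in> Q" "card X = 3"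
      "parcs G = {(u, v). u \<in> Q \<and> v \<in> Q \<and> u \<noteq> v} \<union> {a, b} \<times> X \<union> X \<times> {a, b}"
    then show ?thesis using digraph_iso_B_graph[OF assms(2,3,1)] assms(7) by blast
  qed blast
  then obtain H where H: "sym H" "H \<subseteq> parcs G"
    "\<And>v. v \<in> pverts G \<Longrightarrow> even (card (H `` {v})) \<and> H `` {v} \<noteq> {}"
    by (auto simp: even_cover_def parity_factor_def)
  define F where "F = \<lparr>pverts = pverts G, parcs = H\<rparr>"
  have "H \<subseteq> pverts G \<times> pverts G" using H(2) E_subset by blast
  then have "pair_graph F"
  proof unfold_locales
    show "finite (parcs F)" using H(2) pair_finite_arcs by (auto simp: F_def intro: finite_subset)
    show "symmetric (with_proj F)" using H(1) by (simp add: F_def symmetric_def)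
  qed (use H(2) pair_finite_verts pair_no_loops in \<open>auto simp: F_def\<close>)
  then interpret F: pair_graph F .
  have "spanning (with_proj F) (with_proj G)"
    using H(2) wf_digraph_axioms F.wf_digraph_axioms
    by (simp add: spanning_def subgraph_def compatible_def F_def)
  moreover have "0 < degree_in F v \<and> even (degree_in F v)" if "v \<in> pverts F" for v
    using H(3)[of v] that finite_Image[OF H(2), of "{v}"]
    by (simp add: degree_in_eq_card_Image F_def card_gt_0_iff)
  ultimately show ?thesis using \<open>pair_graph F\<close> unfolding even_factor_def by blast
qed

end
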